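(* Let $1<q<p<\infty$, $1\le r\le\infty$, $1<s<\infty$ and $\gamma>0$. If \[ q\le s,\qquad \frac nq-\frac np<\gamma<n-\frac np, \] then there exists $C>0$ such that for all $t>0$ and all $f\in\mathcal M^p_{q,r}(\mathbb R^n)$, \[ \|e^{t\Delta}[|\cdot|^{-\gamma}f]\|_{L^{s,r}} \le C\, t^{-\frac n2\left(\frac1p-\frac1s\right)-\frac\gamma2} \|f\|_{\mathcal M^p_{q,r}}. \]
   Context: Here $n\ge1$ is the dimension. The heat semigroup $\{e^{t\Delta}\}_{t>0}$ is defined by \[ e^{t\Delta}f(x)=\frac1{\sqrt{(4\pi t)^n}}\int_{\mathbb R^n}\exp\left(-\frac{|x-y|^2}{4t}\right)f(y)\,dy,\quad (t,x)\in(0,\infty)\times\mathbb R^n, \] and $|\cdot|^{-\gamma}f$ denotes the function $x\mapsto|x|^{-\gamma}f(x)$. For $1\le p<\infty$ and $1\le q\le\infty$, the Lorentz space $L^{p,q}(\mathbb R^n)$ is the space of all measurable functions $f$ with finite \[ \|f\|_{L^{p,q}}=\left(\int_0^\infty\left[\lambda\,\|\chi_{\{x\in\mathbb R^n:|f(x)|>\lambda\}}\|_{L^p}\right]^q\frac{d\lambda}\lambda\right)^{\frac1q}\ (q<\infty), \qquad \|f\|_{L^{p,\infty}}=\sup_{\lambda>0}\lambda\,\|\chi_{\{x\in\mathbb R^n:|f(x)|>\lambda\}}\|_{L^p}. \] For $1\le q\le p<\infty$ and $1\le r\le\infty$, the (global) Morrey-type space $\mathcal M^p_{q,r}(\mathbb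 R^n)$ is the space of all measurable functions $f$ with finite norm \[ \|f\|_{\mathcal M^p_{q,r}}=\sup_{x\in\mathbb R^n}\left(\int_0^\infty\left[\rho^{\frac np-\frac nq}\left(\int_{B(x,\rho)}|f(y)|^q\,dy\right)^{\frac1q}\right]^r\frac{d\rho}\rho\right)^{\frac1r}\quad(r<\infty), \] \[ \|f\|_{\mathcal M^p_{q,\infty}}=\sup_{x\in\mathbb R^n,\,\rho>0}\rho^{\frac np-\frac nq}\left(\int_{B(x,\rho)}|f(y)|^q\,dy\right)^{\frac1q}, \] where $B(x,\rho)$ is the ball with center $x$ and radius $\rho$. *)

theory Defs
  imports "HOL-Analysis.Analysis"
begin

text \<open>
  Norms take values in \<^typ>\<open>ennreal\<close>, so that they make sense for every function and
  membership in a space includes finiteness of its norm. "Measurable" means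
  Lebesgue measurable, and functions are complex-valued (which covers real-valued ones).
  An exponent that may be infinite has type \<^typ>\<open>ennreal\<close>.
\<close>

text \<open>Only used with \<open>a > 0\<close>, hence \<open>\<infinity>\<close> to the power \<open>a\<close> is \<open>\<infinity>\<close>.\<close>

definition enn_powr :: "ennreal \<Rightarrow> real \<Rightarrow> ennreal" where
  "enn_powr x a = (if x = \<infinity> then \<infinity> else ennreal (enn2real x powr a))"

definition Lp_norm :: "real \<Rightarrow> ('a::euclidean_space \<Rightarrow> 'b::real_normed_vector) \<Rightarrow> ennreal" where
  "Lp_norm p f = enn_powr (\<integral>\<^sup>+ x. ennreal (norm (f x) powr p) \<partial>lebesgue) (1 / p)"

definition lorentz_norm :: "real \<Rightarrow> ennreal \<Rightarrow> ('a::euclidean_space \<Rightarrow> complex) \<Rightarrow> ennreal" where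
  "lorentz_norm p q f =
    (let \<phi> = (\<lambda>l. ennreal l * Lp_norm p (indicat_real {x. norm (f x) > l}))
     in if q = \<infinity> then (SUP l\<in>{0<..}. \<phi> l)
        else enn_powr (\<integral>\<^sup>+ l\<in>{0<..}. enn_powr (\<phi> l) (enn2real q) / ennreal l \<partial>lborel)
               (1 / enn2real q))"

definition lorentz_space :: "real \<Rightarrow> ennreal \<Rightarrow> ('a::euclidean_space \<Rightarrow> complex) set" where
  "lorentz_space p q = {f \<in> borel_measurable lebesgue. lorentz_norm p q f < \<infinity>}"

definition morrey_norm :: "real \<Rightarrow> real \<Rightarrow> ennreal \<Rightarrow> ('a::euclidean_space \<Rightarrow> complex) \<Rightarrow> ennreal" where
  "morrey_norm p q r f =
    (let n = real DIM('a);
         \<psi> = (\<lambda>x \<rho>. ennreal (\<rho> powr (n / p - n / q)) *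
               enn_powr (\<integral>\<^sup>+ y\<in>ball x \<rho>. ennreal (norm (f y) powr q) \<partial>lebesgue) (1 / q))
     in if r = \<infinity> then (SUP x. SUP \<rho>\<in>{0<..}. \<psi> x \<rho>)
        else (SUP x. enn_powr
               (\<integral>\<^sup>+ \<rho>\<in>{0<..}. enn_powr (\<psi> x \<rho>) (enn2real r) / ennreal \<rho> \<partial>lborel)
               (1 / enn2real r)))"

definition morrey_space :: "real \<Rightarrow> real \<Rightarrow> ennreal \<Rightarrow> ('a::euclidean_space \<Rightarrow> complex) set" where
  "morrey_space p q r = {f \<in> borel_measurable lebesgue. morrey_norm p q r f < \<infinity>}"

definition heat :: "real \<Rightarrow> ('a::euclidean_space \<Rightarrow> complex) \<Rightarrow> 'a \<Rightarrow> complex" where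
  "heat t f x = (1 / sqrt ((4 * pi * t) ^ DIM('a))) *\<^sub>R
     (LINT y|lebesgue. exp (- ((norm (x - y))\<^sup>2 / (4 * t))) *\<^sub>R f y)"

text \<open>
  The Bochner integral of a non-integrable function is \<open>0\<close>; the following predicate says that
  the integral in \<^const>\<open>heat\<close> genuinely converges at every point.
\<close>

definition heat_defined :: "real \<Rightarrow> ('a::euclidean_space \<Rightarrow> complex) \<Rightarrow> bool" where
  "heat_defined t f \<longleftrightarrow>
     (\<forall>x. integrable lebesgue (\<lambda>y. exp (- ((norm (x - y))\<^sup>2 / (4 * t))) *\<^sub>R f y))"

text \<open>The function \<open>|\<cdot>|\<close> to the power \<open>-\<gamma>\<close> times \<open>f\<close>; it gets the value \<open>0\<close> at the null set
  \<open>{0}\<close>, where the power is undefined.\<close>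

definition weight :: "real \<Rightarrow> ('a::euclidean_space \<Rightarrow> complex) \<Rightarrow> 'a \<Rightarrow> complex" where
  "weight \<gamma> f x = (norm x powr (- \<gamma>)) *\<^sub>R f x"

end

theory Submission
  imports Defs
begin

text \<open>
  Write \<open>n\<close> for the dimension, \<open>g = |\<cdot>|\<^sup>-\<^sup>\<gamma> f\<close>, \<open>\<sigma> = \<gamma> + n/p\<close> and \<open>R = \<surd>t\<close>. The hypotheses on \<open>\<gamma>\<close> say
  \<open>n/q < \<sigma> < n\<close>. The upper bound makes \<open>g\<close> integrable near the origin, and the strict lower bound
  leaves room for an exponent \<open>a\<close> with \<open>n/\<sigma> < a < q\<close> for which \<open>g\<close> is in \<open>L\<^sup>a\<close> away from the origin.

  All that is used about \<open>f\<close> is the growth of its mass on balls centred at the origin: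
  \<open>\<parallel>f\<parallel>\<close> in \<open>L\<^sup>q(B(0,\<rho>))\<close> is at most \<open>M \<rho>\<close> to the power \<open>n/q - n/p\<close>, where \<open>M\<close> is a multiple of the
  Morrey-type norm. This follows for every \<open>r\<close> because \<open>\<rho> \<mapsto> \<parallel>f\<parallel>\<close> over \<open>B(0,\<rho>)\<close> increases, so that one
  dyadic interval of radii already bounds the value at its left end (\<open>morrey_norm_ball_le\<close>).
  Summing over dyadic annuli, with \<open>K = M R\<^sup>-\<^sup>\<sigma>\<close> one gets (\<open>nn_integral_weight_le\<close>) that
  the integral of \<open>|g|\<close> over \<open>|y| < R\<close> is at most \<open>B K R\<^sup>n\<close>, and that of \<open>|g|\<^sup>a\<close> over \<open>|y| \<ge> R\<close> is
  at most \<open>B K\<^sup>a R\<^sup>n\<close>. So at the scale \<open>R\<close> of the heat kernel, \<open>g\<close> behaves like a function of size \<open>K\<close>.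

  For such functions the heat flow satisfies two bounds (\<open>heat_L1_plus_La_estimates\<close>): it is at most
  \<open>D K\<close> everywhere, and the set where it exceeds \<open>l\<close> has measure at most \<open>D R\<^sup>n (DK/l)\<^sup>a\<close>. Since
  \<open>a < q \<le> s\<close>, boundedness together with a weak \<open>L\<^sup>a\<close> bound controls the \<open>L\<^sup>s\<^sup>,\<^sup>r\<close> norm for every
  \<open>r\<close> (\<open>lorentz_norm_le\<close>), with the value \<open>C (R\<^sup>n)\<close> to the power \<open>1/s\<close> times \<open>K\<close>. As \<open>R = \<surd>t\<close>,
  this is the required power of \<open>t\<close> times \<open>M\<close>. The choice \<open>a < q\<close> is what reaches the endpoint
  \<open>s = q\<close> and makes the second index \<open>r\<close> harmless.

  In place of Hoelder's inequality and interpolation, each passage between exponents uses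
  the pointwise bound \<open>h\<^sup>u \<le> \<delta>\<^sup>u + \<delta>\<^sup>u\<^sup>-\<^sup>v h\<^sup>v\<close> (\<open>powr_split\<close>) for a well-chosen level \<open>\<delta>\<close>.
\<close>

section \<open>Integrals of powers over measures with polynomial growth\<close>

lemma powr_le_powr_half:
  fixes v \<rho> a :: real
  assumes "0 < \<rho>" "\<rho> / 2 \<le> v" "v < \<rho>"
  shows "v powr - a \<le> 2 powr \<bar>a\<bar> * \<rho> powr - a"
proof (cases "a \<ge> 0")
  case True
  have "v powr - a \<le> (\<rho> / 2) powr - a"
    using assms True by (intro powr_mono2') auto
  also have "\<dots> = 2 powr \<bar>a\<bar> * \<rho> powr - a"
    using assms True by (simp add: powr_divide powr_minus field_simps)
  finally show ?thesis .
next
  case False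
  have "v powr - a \<le> \<rho> powr - a"
    using assms False by (intro powr_mono2) auto
  also have "\<dots> \<le> 2 powr \<bar>a\<bar> * \<rho> powr - a"
    by (simp add: mult_le_cancel_right1 ge_one_powr_ge_zero)
  finally show ?thesis .
qed

text \<open>
  On an annulus \<open>\<rho>/2 \<le> N < \<rho>\<close> the power \<open>N\<^sup>-\<^sup>a\<close> is comparable to \<open>\<rho>\<^sup>-\<^sup>a\<close>, so the annulus contributes
  at most a multiple of \<open>\<rho>\<^sup>b\<^sup>-\<^sup>a\<close>. The function \<open>N\<close> plays the role of a distance; keeping it and the
  measure abstract covers Lebesgue measure, the measures \<open>|f|\<^sup>q dy\<close>, balls with any centre, and
  the half-line.
\<close>

lemma nn_integral_powr_annuli:
  fixes N :: "'b \<Rightarrow> real" and \<rho> :: "nat \<Rightarrow> real"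
  assumes N [measurable]: "N \<in> borel_measurable M"
    and N_nonneg: "\<And>y. 0 \<le> N y"
    and ball: "\<And>\<rho>. \<rho> > 0 \<Longrightarrow> emeasure M {y\<in>space M. N y < \<rho>} \<le> ennreal (c * \<rho> powr b)"
    and "c \<ge> 0"
    and \<rho>: "\<And>k. \<rho> k > 0"
    and cover: "\<And>v. v \<in> S \<Longrightarrow> 0 < v \<Longrightarrow> \<exists>k. \<rho> k / 2 \<le> v \<and> v < \<rho> k"
    and sums: "(\<lambda>k. \<rho> k powr (b - a)) sums \<Sigma>"
  shows "(\<integral>\<^sup>+ y. ennreal (N y powr - a) * indicator S (N y) \<partial>M)
    \<le> ennreal (2 powr \<bar>a\<bar> * c * \<Sigma>)"
proof -
  define h where "h k y = ennreal (2 powr \<bar>a\<bar> * \<rho> k powr - a) * indicator {y\<in>space M. N y < \<rho> k} y"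
    for k y
  have [measurable]: "h k \<in> borel_measurable M" for k
    unfolding h_def by measurable
  have "ennreal (N y powr - a) * indicator S (N y) \<le> (\<Sum>k. h k y)" if "y \<in> space M" for y
  proof (cases "N y \<in> S \<and> 0 < N y")
    case True
    then obtain k where k: "\<rho> k / 2 \<le> N y" "N y < \<rho> k"
      using cover by blast
    have "ennreal (N y powr - a) * indicator S (N y) \<le> h k y"
      using True k that powr_le_powr_half[OF \<rho> k, of a] by (simp add: h_def ennreal_leI)
    also have "\<dots> \<le> (\<Sum>k. h k y)"
      using sum_le_suminf[OF summableI, of "{k}" "\<lambda>k. h k y"] by simp
    finally show ?thesis .
  next
    case False
    then show ?thesis using N_nonneg[of y] by (auto simp: indicator_def)
  qed
  then have "(\<integral>\<^sup>+ y. ennreal (N y powr - a) * indicator S (N y) \<partial>M) \<le> (\<integral>\<^sup>+ y. (\<Sum>k. h k y) \<partial>M)"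
    by (intro nn_integral_mono)
  also have "\<dots> = (\<Sum>k. \<integral>\<^sup>+ y. h k y \<partial>M)"
    by (intro nn_integral_suminf) simp
  also have "\<dots> \<le> (\<Sum>k. ennreal (2 powr \<bar>a\<bar> * c * \<rho> k powr (b - a)))"
  proof (intro suminf_le summableI)
    fix k
    have "(\<integral>\<^sup>+ y. h k y \<partial>M) = ennreal (2 powr \<bar>a\<bar> * \<rho> k powr - a) * emeasure M {y\<in>space M. N y < \<rho> k}"
      unfolding h_def by (subst nn_integral_cmult_indicator) auto
    also have "\<dots> \<le> ennreal (2 powr \<bar>a\<bar> * \<rho> k powr - a) * ennreal (c * \<rho> k powr b)"
      by (intro mult_left_mono ball \<rho>) auto
    also have "\<dots> = ennreal (2 powr \<bar>a\<bar> * c * \<rho> k powr (b - a))"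
      by (simp add: flip: ennreal_mult') (simp add: powr_diff powr_minus field_simps)
    finally show "(\<integral>\<^sup>+ y. h k y \<partial>M) \<le> ennreal (2 powr \<bar>a\<bar> * c * \<rho> k powr (b - a))" .
  qed
  also have "\<dots> = ennreal (2 powr \<bar>a\<bar> * c * \<Sigma>)"
    using \<open>c \<ge> 0\<close> sums by (intro suminf_ennreal_eq sums_mult) auto
  finally show ?thesis .
qed

lemma dyadic_index_below:
  fixes v R :: real
  assumes "0 < v" "v < R"
  shows "\<exists>k. R * (1/2) ^ k / 2 \<le> v \<and> v < R * (1/2) ^ k"
proof -
  define P where "P k \<longleftrightarrow> R * (1/2) ^ k \<le> v" for k :: nat
  have "\<exists>k. (1/2) ^ k < v / R"
    using assms by (intro real_arch_pow_inv) auto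
  then have "\<exists>k. P k"
    using assms by (auto simp: P_def field_simps intro: less_imp_le)
  moreover have "\<not> P 0" using assms by (simp add: P_def)
  ultimately obtain k where "\<not> P k" "P (Suc k)"
    using exists_least_lemma[of P] by blast
  then show ?thesis
    by (intro exI[of _ k]) (auto simp: P_def)
qed

lemma dyadic_index_above:
  fixes v R :: real
  assumes "0 < R" "R \<le> v"
  shows "\<exists>k. R * 2 ^ Suc k / 2 \<le> v \<and> v < R * 2 ^ Suc k"
proof -
  define P where "P k \<longleftrightarrow> v < R * 2 ^ k" for k :: nat
  have "\<exists>k. v / R < 2 ^ k"
    by (intro real_arch_pow) auto
  then have "\<exists>k. P k"
    using assms by (auto simp: P_def field_simps)
  moreover have "\<not> P 0" using assms by (simp add: P_def)
  ultimately obtain k where "\<not> P k" "P (Suc k)"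
    using exists_least_lemma[of P] by blast
  then show ?thesis
    by (intro exI[of _ k]) (auto simp: P_def)
qed

text \<open>
  Comparability of \<open>N\<^sup>-\<^sup>a\<close> on an annulus costs the numerator; the rest is the geometric series with
  ratio \<open>2\<^sup>-\<^sup>|\<^sup>a\<^sup>-\<^sup>b\<^sup>|\<close>.
\<close>

definition dyadic_const :: "real \<Rightarrow> real \<Rightarrow> real" where
  "dyadic_const a b = 2 powr \<bar>a\<bar> / (1 - 2 powr - \<bar>a - b\<bar>)"

lemma dyadic_const_pos: "a \<noteq> b \<Longrightarrow> 0 < dyadic_const a b"
  by (simp add: dyadic_const_def powr_less_one)

text \<open>
  The annuli have radii \<open>R 2\<^sup>-\<^sup>k\<close> below \<open>R\<close> and \<open>R 2\<^sup>k\<^sup>+\<^sup>1\<close> above \<open>R\<close>, and the sign of \<open>b - a\<close> makes the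
  resulting geometric series converge. At points where \<open>N\<close> vanishes the integrand is \<open>0\<close> by the
  convention \<open>0 powr x = 0\<close>.
\<close>

lemma nn_integral_powr_radial:
  fixes N :: "'b \<Rightarrow> real"
  assumes N: "N \<in> borel_measurable M" "\<And>y. 0 \<le> N y"
    and ball: "\<And>\<rho>. \<rho> > 0 \<Longrightarrow> emeasure M {y\<in>space M. N y < \<rho>} \<le> ennreal (c * \<rho> powr b)"
    and c: "c \<ge> 0" and R: "R > 0"
    and S: "S = {..<R} \<and> a < b \<or> S = {R..} \<and> b < a"
  shows "(\<integral>\<^sup>+ y. ennreal (N y powr - a) * indicator S (N y) \<partial>M)
    \<le> ennreal (dyadic_const a b * c * R powr (b - a))"
  using S
proof (elim disjE conjE)
  define \<theta> :: real where "\<theta> = 2 powr - \<bar>a - b\<bar>"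
  {
    assume S: "S = {..<R}" and "a < b"
    then have \<theta>: "0 < \<theta>" "\<theta> < 1" by (auto simp: \<theta>_def powr_less_one)
    have "(\<lambda>k. R powr (b - a) * \<theta> ^ k) sums (R powr (b - a) * (1 / (1 - \<theta>)))"
      using \<theta> by (intro sums_mult geometric_sums) auto
    moreover have "(R * (1/2) ^ k) powr (b - a) = R powr (b - a) * \<theta> ^ k" for k
    proof -
      have "(1/2::real) ^ k = 2 powr - real k"
        by (simp add: powr_minus powr_realpow power_one_over inverse_eq_divide)
      then show ?thesis using R \<open>a < b\<close>
        by (simp add: powr_mult powr_powr \<theta>_def powr_realpow[symmetric] algebra_simps)
    qed
    ultimately have "(\<lambda>k. (R * (1/2) ^ k) powr (b - a)) sums (R powr (b - a) * (1 / (1 - \<theta>)))"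
      by simp
    from nn_integral_powr_annuli[OF N ball c _ _ this, of S]
    show ?thesis
      using R dyadic_index_below[of _ R] by (simp add: S dyadic_const_def \<theta>_def mult_ac)
  }
  {
    assume S: "S = {R..}" and "b < a"
    then have \<theta>: "0 < \<theta>" "\<theta> < 1" by (auto simp: \<theta>_def powr_less_one)
    have "(\<lambda>k. R powr (b - a) * \<theta> * \<theta> ^ k) sums (R powr (b - a) * \<theta> * (1 / (1 - \<theta>)))"
      using \<theta> by (intro sums_mult geometric_sums) auto
    moreover have "(R * 2 ^ Suc k) powr (b - a) = R powr (b - a) * \<theta> * \<theta> ^ k" for k
    proof -
      have "(2::real) ^ Suc k = 2 powr real (Suc k)"
        by (rule powr_realpow[symmetric]) simp
      then have "(R * 2 ^ Suc k) powr (b - a) = R powr (b - a) * \<theta> powr real (Suc k)" using R \<open>b < a\<close>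
        by (simp add: powr_mult powr_powr \<theta>_def mult.commute del: of_nat_Suc power_Suc)
      also have "\<theta> powr real (Suc k) = \<theta> * \<theta> ^ k"
        using \<theta> by (subst powr_realpow) auto
      finally show ?thesis by simp
    qed
    ultimately have "(\<lambda>k. (R * 2 ^ Suc k) powr (b - a)) sums (R powr (b - a) * \<theta> * (1 / (1 - \<theta>)))"
      by simp
    from nn_integral_powr_annuli[OF N ball c _ _ this, of S]
    have "(\<integral>\<^sup>+ y. ennreal (N y powr - a) * indicator S (N y) \<partial>M)
      \<le> ennreal (2 powr \<bar>a\<bar> * c * (R powr (b - a) * \<theta> * (1 / (1 - \<theta>))))"
      using R dyadic_index_above[of R] by (simp add: S)
    also have "\<dots> \<le> ennreal (2 powr \<bar>a\<bar> * c * (R powr (b - a) * 1 * (1 / (1 - \<theta>))))"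
      using \<theta> c by (intro ennreal_leI mult_left_mono mult_right_mono) auto
    finally show ?thesis
      by (simp add: dyadic_const_def \<theta>_def mult_ac)
  }
qed

section \<open>Splitting of powers and measure-theoretic preliminaries\<close>

lemma nn_integral_lincomb:
  fixes c d :: ennreal
  assumes "f \<in> borel_measurable M" "g \<in> borel_measurable M"
  shows "(\<integral>\<^sup>+ x. c * f x + d * g x \<partial>M) = c * (\<integral>\<^sup>+ x. f x \<partial>M) + d * (\<integral>\<^sup>+ x. g x \<partial>M)"
  using assms by (simp add: nn_integral_add nn_integral_cmult)

text \<open>
  The first term bounds the left-hand side where \<open>h \<le> \<delta>\<close>, the second where \<open>h > \<delta>\<close>. Integrating
  this trades a power \<open>u\<close> for a higher power \<open>v\<close> on a set of finite measure, as Hoelder's inequality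
  would.
\<close>

lemma powr_split:
  fixes h \<delta> u v :: real
  assumes "0 \<le> h" "0 < \<delta>" "0 < u" "u \<le> v"
  shows "h powr u \<le> \<delta> powr u + \<delta> powr (u - v) * h powr v"
proof (cases "h \<le> \<delta>")
  case True
  then have "h powr u \<le> \<delta> powr u" using assms by (intro powr_mono2) auto
  also have "\<dots> \<le> \<delta> powr u + \<delta> powr (u - v) * h powr v" by simp
  finally show ?thesis .
next
  case False
  have "h powr u = h powr (u - v) * h powr v" by (simp flip: powr_add)
  also have "\<dots> \<le> \<delta> powr (u - v) * h powr v"
    using assms False by (intro mult_right_mono powr_mono2') auto
  also have "\<dots> \<le> \<delta> powr u + \<delta> powr (u - v) * h powr v" by simp
  finally show ?thesis .
qed

lemma norm_measurable_lebesgue [measurable]: "norm \<in> borel_measurable (lebesgue :: 'a::euclidean_space measure)"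
  by (rule measurable_completion) simp

lemma emeasure_lborel_ball_powr:
  fixes x :: "'a::euclidean_space"
  assumes "0 < \<rho>"
  shows "emeasure lborel (ball x \<rho>) = ennreal (unit_ball_vol (real DIM('a)) * \<rho> powr real DIM('a))"
  using assms by (simp add: emeasure_ball powr_realpow)

lemma emeasure_lborel_norm_less:
  assumes "0 < \<rho>"
  shows "emeasure lborel {y::'a::euclidean_space. norm y < \<rho>}
    = ennreal (unit_ball_vol (real DIM('a)) * \<rho> powr real DIM('a))"
proof -
  have "{y::'a. norm y < \<rho>} = ball 0 \<rho>" by auto
  then show ?thesis using assms by (simp add: emeasure_lborel_ball_powr)
qed

lemma sigma_finite_lebesgue: "sigma_finite_measure (lebesgue :: 'a::euclidean_space measure)"
proof
  show "\<exists>A. countable A \<and> A \<subseteq> sets (lebesgue :: 'a measure) \<and> \<Union> A = space lebesgue \<and>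
      (\<forall>a\<in>A. emeasure lebesgue a \<noteq> \<infinity>)"
  proof (intro exI[of _ "range (\<lambda>k. ball (0::'a) (real k))"] conjI)
    show "\<Union> (range (\<lambda>k. ball (0::'a) (real k))) = space lebesgue"
      using reals_Archimedean2 by (auto simp: space_completion)
    show "\<forall>a\<in>range (\<lambda>k. ball (0::'a) (real k)). emeasure lebesgue a \<noteq> \<infinity>"
      using emeasure_lborel_ball_finite[of "0::'a"] by (auto simp: less_top)
  qed auto
qed

section \<open>Lorentz and Morrey-type norms\<close>

lemma enn_powr_ennreal: "0 \<le> x \<Longrightarrow> enn_powr (ennreal x) a = ennreal (x powr a)"
  by (simp add: enn_powr_def)

lemma enn_powr_0 [simp]: "enn_powr 0 a = 0"
  by (simp add: enn_powr_def)

lemma enn_powr_mono: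
  assumes "x \<le> y" "0 \<le> a"
  shows "enn_powr x a \<le> enn_powr y a"
proof (cases "y = \<infinity>")
  case False
  then have "x \<noteq> \<infinity>" using assms by (auto simp: top_unique)
  moreover have "enn2real x \<le> enn2real y"
    using assms False by (intro enn2real_mono) (auto simp: less_top)
  ultimately show ?thesis
    using assms False by (auto simp: enn_powr_def intro!: ennreal_leI powr_mono2)
qed (simp add: enn_powr_def)

lemma enn_powr_inverse:
  assumes "0 < a"
  shows "enn_powr (enn_powr x a) (1 / a) = x"
proof (cases "x = \<infinity>")
  case False
  then obtain z where "0 \<le> z" "x = ennreal z" by (cases x) auto
  then show ?thesis using assms by (simp add: enn_powr_ennreal powr_powr)
qed (simp add: enn_powr_def)

lemma le_of_enn_powr_le:
  assumes "enn_powr x (1 / a) \<le> ennreal b" "0 < a" "0 \<le> b"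
  shows "x \<le> ennreal (b powr a)"
proof -
  have "x = enn_powr (enn_powr x (1 / a)) a"
    using enn_powr_inverse[of "1 / a" x] assms by simp
  also have "\<dots> \<le> enn_powr (ennreal b) a"
    using assms by (intro enn_powr_mono) auto
  finally show ?thesis using assms by (simp add: enn_powr_ennreal)
qed

lemma enn_powr_mult_ennreal:
  assumes "0 \<le> c" "0 < a"
  shows "enn_powr (ennreal c * x) a = (if c = 0 then 0 else ennreal (c powr a) * enn_powr x a)"
proof (cases "x = \<infinity>")
  case True
  then show ?thesis using assms by (auto simp: enn_powr_def ennreal_mult_top)
next
  case False
  then obtain z where "0 \<le> z" "x = ennreal z" by (cases x) auto
  then show ?thesis using assms
    by (simp add: enn_powr_ennreal powr_mult flip: ennreal_mult)
qed

lemma Lp_norm_indicat: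
  assumes "E \<in> sets lebesgue"
  shows "Lp_norm s (indicat_real E) = enn_powr (emeasure lebesgue E) (1 / s)"
proof -
  have "(\<lambda>x. ennreal (norm (indicat_real E x) powr s)) = indicator E"
    by (auto simp: indicator_def)
  then show ?thesis using assms by (simp add: Lp_norm_def)
qed

lemma real_ge_1_of_ennreal:
  assumes "(1::ennreal) \<le> r" "r \<noteq> \<infinity>"
  shows "1 \<le> enn2real r"
  using enn2real_mono[of 1 r] assms by (simp add: less_top)

text \<open>
  This is the one-dimensional instance of the dyadic estimate with \<open>|l|\<close> as the distance and growth
  exponent \<open>1\<close>; the factor \<open>2\<close> is the length of \<open>(-1, 1)\<close>.
\<close>

lemma nn_integral_powr_Ioo:
  assumes "0 < L" "0 < \<kappa>"
  shows "(\<integral>\<^sup>+ l\<in>{0<..}. ennreal (l powr (\<kappa> - 1)) * indicator {..<L} l \<partial>lborel)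
    \<le> ennreal (dyadic_const (1 - \<kappa>) 1 * 2 * L powr \<kappa>)"
proof -
  have "(\<integral>\<^sup>+ l\<in>{0<..}. ennreal (l powr (\<kappa> - 1)) * indicator {..<L} l \<partial>lborel)
    \<le> (\<integral>\<^sup>+ l. ennreal (\<bar>l\<bar> powr - (1 - \<kappa>)) * indicator {..<L} \<bar>l\<bar> \<partial>lborel)"
    by (intro nn_integral_mono) (auto simp: indicator_def)
  also have "\<dots> \<le> ennreal (dyadic_const (1 - \<kappa>) 1 * 2 * L powr (1 - (1 - \<kappa>)))"
  proof (rule nn_integral_powr_radial)
    fix \<rho> :: real assume "0 < \<rho>"
    moreover have "{y\<in>space lborel. \<bar>y\<bar> < \<rho>} = {-\<rho><..<\<rho>}" by auto
    ultimately show "emeasure lborel {y\<in>space lborel. \<bar>y\<bar> < \<rho>} \<le> ennreal (2 * \<rho> powr 1)"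
      by simp
  qed (use assms in auto)
  finally show ?thesis by simp
qed

text \<open>
  Functions that are bounded and in weak \<open>L\<^sup>a\<close> belong to \<open>L\<^sup>s\<^sup>,\<^sup>r\<close> for all \<open>s > a\<close>: levels above \<open>L\<close> do
  not contribute, and below \<open>L\<close> the quantity \<open>l |{|h| > l}|\<^sup>1\<^sup>/\<^sup>s\<close> is at most
  \<open>V\<^sup>1\<^sup>/\<^sup>s L (l/L)\<^sup>\<beta>\<close> with \<open>\<beta> = 1 - a/s > 0\<close>, which is integrable to any power against \<open>dl/l\<close>.
\<close>

lemma lorentz_norm_le:
  fixes a s :: real and r :: ennreal
  assumes "0 < a" "a < s" "1 \<le> r"
  shows "\<exists>C>0. \<forall>(h :: 'a::euclidean_space \<Rightarrow> complex) L V.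
    h \<in> borel_measurable lebesgue \<longrightarrow> 0 < L \<longrightarrow> 0 < V \<longrightarrow> (\<forall>x. norm (h x) \<le> L) \<longrightarrow>
    (\<forall>l. 0 < l \<longrightarrow> l < L \<longrightarrow> emeasure lebesgue {x. norm (h x) > l} \<le> ennreal (V * (L / l) powr a)) \<longrightarrow>
    lorentz_norm s r h \<le> ennreal (C * V powr (1 / s) * L)"
proof -
  define \<beta> where "\<beta> = 1 - a / s"
  have \<beta>: "0 < \<beta>" "\<beta> \<le> 1" using assms by (auto simp: \<beta>_def)
  define r' where "r' = enn2real r"
  define D where "D = dyadic_const (1 - \<beta> * r') 1 * 2"
  define C where "C = (if r = \<infinity> then 1 else D powr (1 / r'))"
  have r': "1 \<le> r'" if "r \<noteq> \<infinity>"
    using real_ge_1_of_ennreal that assms by (simp add: r'_def)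
  have D: "0 < D" if "r \<noteq> \<infinity>"
    using \<beta> r'[OF that] by (auto simp: D_def intro!: dyadic_const_pos)
  have "0 < C" using D by (auto simp: C_def)
  have main: "lorentz_norm s r h \<le> ennreal (C * V powr (1 / s) * L)"
    if h [measurable]: "h \<in> borel_measurable lebesgue" and "0 < L" "0 < V" and sup: "\<forall>x. norm (h x) \<le> L"
      and dist: "\<forall>l. 0 < l \<longrightarrow> l < L \<longrightarrow> emeasure lebesgue {x. norm (h x) > l} \<le> ennreal (V * (L / l) powr a)"
    for h :: "'a \<Rightarrow> complex" and L V
  proof -
    define \<phi> where "\<phi> l = ennreal l * Lp_norm s (indicat_real {x. norm (h x) > l})" for l
    define U where "U = V powr (1 / s) * L"
    have U: "0 < U" using \<open>0 < L\<close> \<open>0 < V\<close> by (simp add: U_def)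
    have \<phi>_le: "\<phi> l \<le> ennreal (U * (l / L) powr \<beta>) * indicator {..<L} l" if "0 < l" for l
    proof (cases "l < L")
      case False
      then have empty: "{x. norm (h x) > l} = {}" using sup by (auto simp: not_less intro: order_trans)
      show ?thesis unfolding \<phi>_def empty using Lp_norm_indicat[of "{}::'a set"] by simp
    next
      case True
      have [measurable]: "{x. norm (h x) > l} \<in> sets lebesgue"
        using measurable_sets[of "\<lambda>x. norm (h x)" lebesgue borel "{l<..}"]
        by (simp add: vimage_def)
      have "\<phi> l \<le> ennreal l * enn_powr (ennreal (V * (L / l) powr a)) (1 / s)"
        unfolding \<phi>_def using True dist \<open>0 < l\<close> assms
        by (subst Lp_norm_indicat) (auto intro!: mult_left_mono enn_powr_mono)
      also have "\<dots> = ennreal (l * (V * (L / l) powr a) powr (1 / s))"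
        using \<open>0 < l\<close> \<open>0 < V\<close>
        by (subst enn_powr_ennreal) (auto simp: ennreal_mult'[of l])
      also have "l * (V * (L / l) powr a) powr (1 / s) = U * (l / L) powr \<beta>"
      proof -
        have "(V * (L / l) powr a) powr (1 / s) = V powr (1 / s) * (L / l) powr (a / s)"
          using \<open>0 < V\<close> by (simp add: powr_mult powr_powr)
        also have "(L / l) powr (a / s) = (l / L) powr (- (a / s))"
          using \<open>0 < l\<close> \<open>0 < L\<close> by (simp add: powr_divide powr_minus field_simps)
        finally show ?thesis
          using \<open>0 < l\<close> \<open>0 < L\<close> by (simp add: U_def \<beta>_def powr_diff powr_minus field_simps)
      qed
      finally show ?thesis using True by simp
    qed
    show ?thesis
    proof (cases "r = \<infinity>")
      case True
      have "\<phi> l \<le> ennreal U" if "0 < l" for l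
      proof (cases "l < L")
        case True
        then have "(l / L) powr \<beta> \<le> 1"
          using that \<beta> by (intro powr_le1) auto
        then have "U * (l / L) powr \<beta> \<le> U" using U by (simp add: mult_le_cancel_left2)
        then show ?thesis using \<phi>_le[OF that] True ennreal_leI order_trans by fastforce
      next
        case False
        then show ?thesis using \<phi>_le[OF that] by simp
      qed
      then show ?thesis
        using True by (auto simp: lorentz_norm_def C_def Let_def \<phi>_def[symmetric] U_def[symmetric] intro!: SUP_least)
    next
      case False
      note r' = r'[OF False] and D = D[OF False]
      define W where "W = U powr r' * L powr (- \<beta> * r')"
      have "W \<ge> 0" by (simp add: W_def)
      have "enn_powr (\<phi> l) r' / ennreal l \<le> ennreal W * (ennreal (l powr (\<beta> * r' - 1)) * indicator {..<L} l)"
        if "0 < l" for l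
      proof (cases "l < L")
        case True
        have "enn_powr (\<phi> l) r' / ennreal l \<le> enn_powr (ennreal (U * (l / L) powr \<beta>)) r' / ennreal l"
          using \<phi>_le[OF that] True r' by (intro divide_right_mono_ennreal enn_powr_mono) auto
        also have "\<dots> = ennreal ((U * (l / L) powr \<beta>) powr r' / l)"
          using U that by (simp add: enn_powr_ennreal divide_ennreal)
        also have "(U * (l / L) powr \<beta>) powr r' / l = W * l powr (\<beta> * r' - 1)"
          using U that \<open>0 < L\<close>
          by (simp add: W_def powr_mult powr_powr powr_divide powr_diff powr_minus field_simps)
        finally show ?thesis using True \<open>W \<ge> 0\<close> by (simp add: ennreal_mult')
      next
        case False
        then show ?thesis using \<phi>_le[OF that] by simp
      qed
      then have "(\<integral>\<^sup>+ l\<in>{0<..}. enn_powr (\<phi> l) r' / ennreal l \<partial>lborel)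
        \<le> (\<integral>\<^sup>+ l. ennreal W * (ennreal (l powr (\<beta> * r' - 1)) * indicator {..<L} l * indicator {0<..} l) \<partial>lborel)"
        by (intro nn_integral_mono) (auto simp: indicator_def)
      also have "\<dots> = ennreal W * (\<integral>\<^sup>+ l. (ennreal (l powr (\<beta> * r' - 1)) * indicator {..<L} l * indicator {0<..} l) \<partial>lborel)"
        by (intro nn_integral_cmult) measurable
      also have "\<dots> \<le> ennreal W * ennreal (D * L powr (\<beta> * r'))"
        unfolding D_def using nn_integral_powr_Ioo[of L "\<beta> * r'"] \<open>0 < L\<close> \<beta> r' by (intro mult_left_mono) auto
      also have "\<dots> = ennreal (D * U powr r')"
        using \<open>0 < L\<close> \<open>W \<ge> 0\<close>
        by (subst ennreal_mult'[symmetric]) (auto simp: W_def powr_minus field_simps)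
      finally have *: "(\<integral>\<^sup>+ l\<in>{0<..}. enn_powr (\<phi> l) r' / ennreal l \<partial>lborel) \<le> ennreal (D * U powr r')" .
      have "lorentz_norm s r h = enn_powr (\<integral>\<^sup>+ l\<in>{0<..}. enn_powr (\<phi> l) r' / ennreal l \<partial>lborel) (1 / r')"
        using False by (simp add: lorentz_norm_def \<phi>_def r'_def)
      also have "\<dots> \<le> enn_powr (ennreal (D * U powr r')) (1 / r')"
        using r' by (intro enn_powr_mono *) auto
      also have "\<dots> = ennreal (D powr (1 / r') * U)"
        using D U r' by (simp add: enn_powr_ennreal powr_mult powr_powr)
      finally show ?thesis using False by (simp add: C_def U_def mult_ac)
    qed
  qed
  show ?thesis
    using main \<open>0 < C\<close> by blast
qed

text \<open>
  This is the embedding of the Morrey-type space with index \<open>r\<close> into the one with index \<open>\<infinity>\<close>. For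
  finite \<open>r\<close> the integral over the radii in \<open>[\<rho>, 2\<rho>)\<close> is bounded below by monotonicity: the
  mass on the larger ball is at least that on \<open>B(x,\<rho>)\<close>, and the power of the radius and \<open>d\<rho>/\<rho>\<close> lose
  only constants.
\<close>

lemma morrey_norm_ball_le:
  fixes p q :: real and r :: ennreal
  assumes "0 < q" "q < p" "1 \<le> r"
  shows "\<exists>c>0. \<forall>(f :: 'a::euclidean_space \<Rightarrow> complex) x. \<forall>\<rho>>0.
    ennreal (\<rho> powr (real DIM('a) / p - real DIM('a) / q)) *
      enn_powr (\<integral>\<^sup>+ y\<in>ball x \<rho>. ennreal (norm (f y) powr q) \<partial>lebesgue) (1 / q)
    \<le> ennreal c * morrey_norm p q r f"
proof -
  define e where "e = real DIM('a) / q - real DIM('a) / p"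
  have e: "0 \<le> e" using assms by (simp add: e_def frac_le)
  define r' where "r' = enn2real r"
  define c where "c = (if r = \<infinity> then 1 else 2 powr e * 2 powr (1 / r'))"
  have "0 < c" by (simp add: c_def)
  have main: "ennreal (\<rho> powr - e) * enn_powr (\<integral>\<^sup>+ y\<in>ball x \<rho>. ennreal (norm (f y) powr q) \<partial>lebesgue) (1 / q)
    \<le> ennreal c * morrey_norm p q r f" if "\<rho> > 0" for f :: "'a \<Rightarrow> complex" and x \<rho>
  proof -
    define E where "E \<rho> = enn_powr (\<integral>\<^sup>+ y\<in>ball x \<rho>. ennreal (norm (f y) powr q) \<partial>lebesgue) (1 / q)" for \<rho>
    define \<psi> where "\<psi> \<rho> = ennreal (\<rho> powr - e) * E \<rho>" for \<rho>
    have E_mono: "E \<rho> \<le> E \<rho>'" if "\<rho> \<le> \<rho>'" for \<rho> \<rho>'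
      unfolding E_def using that assms
      by (intro enn_powr_mono nn_integral_mono mult_left_mono) (auto simp: indicator_def)
    have ee: "real DIM('a) / p - real DIM('a) / q = - e" by (simp add: e_def)
    show ?thesis
    proof (cases "r = \<infinity>")
      case True
      have "\<psi> \<rho> \<le> morrey_norm p q r f"
        unfolding morrey_norm_def Let_def ee \<psi>_def E_def using True that
        by (auto intro!: SUP_upper2[of x] SUP_upper2[of \<rho>])
      then show ?thesis using True by (simp add: c_def \<psi>_def E_def)
    next
      case False
      have r': "1 \<le> r'" using real_ge_1_of_ennreal False assms by (simp add: r'_def)
      define J where "J = (\<integral>\<^sup>+ \<rho>\<in>{0<..}. enn_powr (\<psi> \<rho>) r' / ennreal \<rho> \<partial>lborel)"
      have J: "enn_powr J (1 / r') \<le> morrey_norm p q r f"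
        unfolding morrey_norm_def Let_def ee J_def \<psi>_def E_def r'_def using False
        by (auto intro!: SUP_upper2[of x])
      \<comment> \<open>A lower bound for \<open>\<psi>\<close> on the whole interval \<open>[\<rho>, 2\<rho>)\<close>.\<close>
      define m where "m = ennreal (2 powr - e) * \<psi> \<rho>"
      have "m \<le> \<psi> \<rho>'" if "\<rho> \<le> \<rho>'" "\<rho>' < 2 * \<rho>" for \<rho>'
      proof -
        have "m = ennreal ((2 * \<rho>) powr - e) * E \<rho>"
          using \<open>\<rho> > 0\<close> by (simp add: m_def \<psi>_def powr_mult ennreal_mult' mult.assoc)
        also have "\<dots> \<le> ennreal (\<rho>' powr - e) * E \<rho>'"
          using that \<open>\<rho> > 0\<close> e by (intro mult_mono E_mono ennreal_leI powr_mono2') auto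
        finally show ?thesis by (simp add: \<psi>_def)
      qed
      moreover have "inverse (ennreal (2 * \<rho>)) \<le> inverse (ennreal \<rho>')"
        if "\<rho> \<le> \<rho>'" "\<rho>' < 2 * \<rho>" for \<rho>'
        using that \<open>\<rho> > 0\<close> by (auto simp: inverse_ennreal simp del: inverse_mult_distrib intro!: ennreal_leI le_imp_inverse_le)
      ultimately have "enn_powr m r' / ennreal (2 * \<rho>) * indicator {\<rho>..<2 * \<rho>} \<rho>'
          \<le> enn_powr (\<psi> \<rho>') r' / ennreal \<rho>' * indicator {0<..} \<rho>'" for \<rho>'
        using \<open>\<rho> > 0\<close> r'
        by (auto simp: indicator_def divide_ennreal_def intro!: mult_mono enn_powr_mono)
      then have "(\<integral>\<^sup>+ \<rho>'. enn_powr m r' / ennreal (2 * \<rho>) * indicator {\<rho>..<2 * \<rho>} \<rho>' \<partial>lborel) \<le> J"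
        unfolding J_def by (intro nn_integral_mono)
      moreover have "(\<integral>\<^sup>+ \<rho>'. enn_powr m r' / ennreal (2 * \<rho>) * indicator {\<rho>..<2 * \<rho>} \<rho>' \<partial>lborel)
          = enn_powr m r' / ennreal (2 * \<rho>) * ennreal \<rho>"
        using \<open>\<rho> > 0\<close> by (subst nn_integral_cmult_indicator) auto
      moreover have "enn_powr m r' / ennreal (2 * \<rho>) * ennreal \<rho> = ennreal (1 / 2) * enn_powr m r'"
      proof -
        have "inverse (ennreal (2 * \<rho>)) * ennreal \<rho> = ennreal (1 / 2)"
          using \<open>\<rho> > 0\<close> by (simp add: inverse_ennreal flip: ennreal_mult')
        then show ?thesis
          by (simp only: divide_ennreal_def mult.assoc mult.commute[of "ennreal (1 / 2)"])
      qed
      ultimately have "ennreal (1 / 2) * enn_powr m r' \<le> J" by simp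
      then have "enn_powr (ennreal (1 / 2) * enn_powr m r') (1 / r') \<le> morrey_norm p q r f"
        using r' J by (intro order_trans[OF enn_powr_mono J]) auto
      then have "ennreal ((1 / 2) powr (1 / r')) * m \<le> morrey_norm p q r f"
        using r' by (subst (asm) enn_powr_mult_ennreal) (auto simp: enn_powr_inverse)
      then have "ennreal c * (ennreal ((1 / 2) powr (1 / r')) * m) \<le> ennreal c * morrey_norm p q r f"
        by (intro mult_left_mono) auto
      moreover have "ennreal c * (ennreal ((1 / 2) powr (1 / r')) * m) = \<psi> \<rho>"
        using False by (simp add: m_def c_def powr_divide powr_minus field_simps flip: mult.assoc ennreal_mult')
      ultimately show ?thesis by (simp add: \<psi>_def E_def)
    qed
  qed
  show ?thesis
    using main \<open>0 < c\<close> by (intro exI[of _ c]) (simp add: e_def)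
qed

section \<open>Integrability of the weighted function near and away from the origin\<close>

text \<open>
  The first summand comes from the part of \<open>|f|\<close> below the natural size \<open>M |y|\<^sup>-\<^sup>n\<^sup>/\<^sup>p\<close>, the second from
  the part above it.
\<close>

definition weight_const :: "real \<Rightarrow> real \<Rightarrow> real \<Rightarrow> real \<Rightarrow> real \<Rightarrow> real" where
  "weight_const n p q \<gamma> u =
    dyadic_const (u * (\<gamma> + n / p)) n * unit_ball_vol n +
    dyadic_const (u * \<gamma> + n / p * (u - q)) (n - n / p * q)"

text \<open>
  The growth bound on balls says that on average \<open>|f(y)|\<close> is at most about \<open>\<delta>(y) = M |y|\<^sup>-\<^sup>n\<^sup>/\<^sup>p\<close>.
  Splitting \<open>|f|\<^sup>u \<le> \<delta>\<^sup>u + \<delta>\<^sup>u\<^sup>-\<^sup>q |f|\<^sup>q\<close> at this level leaves the integral of a power of \<open>|y|\<close>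
  against Lebesgue measure, which grows like \<open>\<rho>\<^sup>n\<close> on balls, and another against \<open>|f|\<^sup>q dy\<close>, which
  grows like \<open>\<rho>\<close> to the power \<open>n - nq/p\<close>. In both the growth exponent exceeds the exponent of the
  singularity by the same amount \<open>n - u\<sigma>\<close>, so one sign condition decides whether the region inside
  or the region outside \<open>|y| = R\<close> is admissible.
\<close>

lemma nn_integral_weight_le:
  fixes f :: "'a::euclidean_space \<Rightarrow> complex" and p q \<gamma> u M R :: real
  defines "n \<equiv> real DIM('a)"
  defines "\<sigma> \<equiv> \<gamma> + n / p"
  assumes f [measurable]: "f \<in> borel_measurable lebesgue"
    and "0 < M" "0 < R" "0 < u" "u \<le> q"
    and ball: "\<And>\<rho>. 0 < \<rho> \<Longrightarrow> (\<integral>\<^sup>+ y\<in>ball 0 \<rho>. ennreal (norm (f y) powr q) \<partial>lebesgue)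
      \<le> ennreal ((M * \<rho> powr (n / q - n / p)) powr q)"
    and S: "S = {..<R} \<and> u * \<sigma> < n \<or> S = {R..} \<and> n < u * \<sigma>"
  shows "(\<integral>\<^sup>+ y. ennreal (norm (weight \<gamma> f y) powr u) * indicator S (norm y) \<partial>lebesgue)
    \<le> ennreal (weight_const n p q \<gamma> u * M powr u * R powr (n - u * \<sigma>))"
proof -
  define a b where "a = u * \<gamma> + n / p * (u - q)" and "b = n - n / p * q"
  have ab: "b - a = n - u * \<sigma>" by (simp add: a_def b_def \<sigma>_def algebra_simps diff_divide_distrib)
  have [measurable]: "S \<in> sets borel" using S by auto
  define w where "w y = ennreal (norm (f y) powr q)" for y
  have [measurable]: "w \<in> borel_measurable lebesgue" unfolding w_def by measurable
  have pw: "norm (weight \<gamma> f y) powr u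
    \<le> M powr u * norm y powr - (u * \<sigma>) + M powr (u - q) * (norm y powr - a * norm (f y) powr q)" for y
  proof (cases "y = 0")
    case False
    \<comment> \<open>The size that the growth bound on balls predicts for \<open>|f(y)|\<close>.\<close>
    define \<delta> where "\<delta> = M * norm y powr - (n / p)"
    have \<delta>: "0 < \<delta>" using False \<open>0 < M\<close> by (simp add: \<delta>_def)
    have "norm (weight \<gamma> f y) powr u = norm y powr - (u * \<gamma>) * norm (f y) powr u"
      by (simp add: weight_def powr_mult powr_powr mult.commute)
    also have "\<dots> \<le> norm y powr - (u * \<gamma>) * (\<delta> powr u + \<delta> powr (u - q) * norm (f y) powr q)"
      using \<open>0 < u\<close> \<open>u \<le> q\<close> \<delta> by (intro mult_left_mono powr_split) auto
    also have "\<delta> powr u = M powr u * norm y powr (- (n / p) * u)"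
      using \<open>0 < M\<close> by (simp add: \<delta>_def powr_mult powr_powr)
    also have "\<delta> powr (u - q) = M powr (u - q) * norm y powr (- (n / p) * (u - q))"
      using \<open>0 < M\<close> by (simp add: \<delta>_def powr_mult powr_powr)
    also have "norm y powr - (u * \<gamma>) * (M powr u * norm y powr (- (n / p) * u) +
        M powr (u - q) * norm y powr (- (n / p) * (u - q)) * norm (f y) powr q)
      = M powr u * (norm y powr - (u * \<gamma>) * norm y powr (- (n / p) * u))
      + M powr (u - q) * ((norm y powr - (u * \<gamma>) * norm y powr (- (n / p) * (u - q))) * norm (f y) powr q)"
      by (simp add: algebra_simps)
    also have "norm y powr - (u * \<gamma>) * norm y powr (- (n / p) * u) = norm y powr - (u * \<sigma>)"
      by (simp add: \<sigma>_def algebra_simps flip: powr_add)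
    also have "norm y powr - (u * \<gamma>) * norm y powr (- (n / p) * (u - q)) = norm y powr - a"
      by (simp add: a_def algebra_simps diff_divide_distrib flip: powr_add)
    finally show ?thesis .
  qed (simp add: weight_def)
  define I where "I = (\<integral>\<^sup>+ y. ennreal (norm y powr - (u * \<sigma>)) * indicator S (norm y) \<partial>(lebesgue :: 'a measure))"
  define J where "J = (\<integral>\<^sup>+ y. ennreal (norm y powr - a) * indicator S (norm y) \<partial>(density lebesgue w))"
  have I: "I \<le> ennreal (dyadic_const (u * \<sigma>) n * unit_ball_vol n * R powr (n - u * \<sigma>))"
    unfolding I_def using S \<open>0 < R\<close>
    by (intro nn_integral_powr_radial) (auto simp: n_def emeasure_lborel_norm_less)
  have J: "J \<le> ennreal (dyadic_const a b * M powr q * R powr (b - a))"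
    unfolding J_def
  proof (rule nn_integral_powr_radial)
    fix \<rho> :: real assume "0 < \<rho>"
    have "{y\<in>space (density lebesgue w). norm y < \<rho>} = ball 0 \<rho>" by auto
    then have "emeasure (density lebesgue w) {y\<in>space (density lebesgue w). norm y < \<rho>}
      = (\<integral>\<^sup>+ y\<in>ball 0 \<rho>. ennreal (norm (f y) powr q) \<partial>lebesgue)"
      by (simp add: emeasure_density w_def)
    also have "\<dots> \<le> ennreal ((M * \<rho> powr (n / q - n / p)) powr q)"
      by (rule ball) fact
    also have "(M * \<rho> powr (n / q - n / p)) powr q = M powr q * \<rho> powr b"
      using \<open>0 < M\<close> \<open>0 < u\<close> \<open>u \<le> q\<close> by (simp add: powr_mult powr_powr b_def algebra_simps)
    finally show "emeasure (density lebesgue w) {y\<in>space (density lebesgue w). norm y < \<rho>}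
      \<le> ennreal (M powr q * \<rho> powr b)" .
  next
    show "S = {..<R} \<and> a < b \<or> S = {R..} \<and> b < a"
      using S ab by auto
  qed (use \<open>0 < R\<close> in auto)
  have "(\<integral>\<^sup>+ y. ennreal (norm (weight \<gamma> f y) powr u) * indicator S (norm y) \<partial>lebesgue)
    \<le> (\<integral>\<^sup>+ y. ennreal (M powr u) * (ennreal (norm y powr - (u * \<sigma>)) * indicator S (norm y))
        + ennreal (M powr (u - q)) * (w y * (ennreal (norm y powr - a) * indicator S (norm y))) \<partial>lebesgue)"
  proof (intro nn_integral_mono)
    fix y
    have "ennreal (norm (weight \<gamma> f y) powr u)
      \<le> ennreal (M powr u * norm y powr - (u * \<sigma>) + M powr (u - q) * (norm y powr - a * norm (f y) powr q))"
      by (intro ennreal_leI pw)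
    also have "\<dots> = ennreal (M powr u) * ennreal (norm y powr - (u * \<sigma>))
        + ennreal (M powr (u - q)) * (w y * ennreal (norm y powr - a))"
      by (simp add: w_def ennreal_mult mult.commute)
    finally show "ennreal (norm (weight \<gamma> f y) powr u) * indicator S (norm y)
      \<le> ennreal (M powr u) * (ennreal (norm y powr - (u * \<sigma>)) * indicator S (norm y))
        + ennreal (M powr (u - q)) * (w y * (ennreal (norm y powr - a) * indicator S (norm y)))"
      by (cases "norm y \<in> S") auto
  qed
  also have "\<dots> = ennreal (M powr u) * I + ennreal (M powr (u - q)) * J"
    unfolding I_def J_def
    by (subst nn_integral_density, measurable, rule nn_integral_lincomb) measurable
  also have "\<dots> \<le> ennreal (M powr u) * ennreal (dyadic_const (u * \<sigma>) n * unit_ball_vol n * R powr (n - u * \<sigma>))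
      + ennreal (M powr (u - q)) * ennreal (dyadic_const a b * M powr q * R powr (b - a))"
    using I J by (intro add_mono mult_left_mono) auto
  also have "\<dots> = ennreal (weight_const n p q \<gamma> u * M powr u * R powr (n - u * \<sigma>))"
  proof -
    have wc: "weight_const n p q \<gamma> u = dyadic_const (u * \<sigma>) n * unit_ball_vol n + dyadic_const a b"
      by (simp add: weight_const_def \<sigma>_def a_def b_def)
    have "u * \<sigma> \<noteq> n" "a \<noteq> b" using S ab by auto
    then have "0 < dyadic_const (u * \<sigma>) n" "0 < dyadic_const a b" by (auto intro: dyadic_const_pos)
    moreover have "0 \<le> unit_ball_vol n" by (simp add: n_def)
    moreover have "M powr (u - q) * M powr q = M powr u" by (simp flip: powr_add)
    then have "M powr (u - q) * (dyadic_const a b * M powr q * R powr (b - a))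
      = dyadic_const a b * M powr u * R powr (n - u * \<sigma>)" by (simp add: ab mult_ac)
    ultimately show ?thesis
      by (simp add: wc algebra_simps
          flip: ennreal_mult' ennreal_plus)
  qed
  finally show ?thesis .
qed

section \<open>The heat flow on sums of Lebesgue spaces\<close>

abbreviation gauss :: "real \<Rightarrow> 'a::euclidean_space \<Rightarrow> 'a \<Rightarrow> real" where
  "gauss t x y \<equiv> exp (- ((norm (x - y))\<^sup>2 / (4 * t)))"

lemma exp_minus_le_powr:
  fixes v :: real
  assumes "0 < v"
  shows "exp (- v) \<le> fact k * v powr - real k"
proof -
  have "v ^ k / fact k \<le> exp v"
    using assms sum_le_suminf[OF summable_exp[of v], of "{k}"]
    by (simp add: exp_def divide_inverse mult.commute)
  then have "inverse (exp v) \<le> inverse (v ^ k / fact k)"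
    using assms by (intro le_imp_inverse_le) auto
  then show ?thesis
    using assms by (simp add: exp_minus powr_minus powr_realpow field_simps)
qed

lemma gauss_measurable [measurable]:
  "(\<lambda>y::'a::euclidean_space. gauss t x y) \<in> borel_measurable borel"
  "(\<lambda>y::'a::euclidean_space. gauss t x y) \<in> borel_measurable lebesgue"
proof -
  show "(\<lambda>y::'a::euclidean_space. gauss t x y) \<in> borel_measurable borel" by measurable
  then show "(\<lambda>y::'a::euclidean_space. gauss t x y) \<in> borel_measurable lebesgue"
    by (simp add: measurable_completion)
qed

lemma gauss_pair_measurable [measurable]:
  "(\<lambda>z. gauss t (fst z) (snd z)) \<in> borel_measurable (borel \<Otimes>\<^sub>M (lebesgue :: 'a::euclidean_space measure))"
proof -
  have [measurable]: "fst \<in> borel_measurable (borel \<Otimes>\<^sub>M (lebesgue :: 'a::euclidean_space measure))"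
    using measurable_fst[of borel lebesgue] by simp
  have [measurable]: "snd \<in> borel_measurable (borel \<Otimes>\<^sub>M (lebesgue :: 'a::euclidean_space measure))"
    using measurable_compose[OF measurable_snd id_borel_measurable_lebesgue] by (simp add: id_def)
  show ?thesis by measurable
qed

text \<open>
  The scaling in \<open>t\<close> comes from a cruder majorant with the same scaling: the Gaussian is bounded
  by \<open>1\<close> on the ball of radius \<open>R = \<surd>t\<close> and by a multiple of \<open>(R/|x - y|)\<^sup>2\<^sup>n\<close> outside, where the
  dyadic estimate applies with \<open>2n > n\<close>.
\<close>

lemma nn_integral_gauss_le:
  "\<exists>C>0. \<forall>t>0. \<forall>x::'a::euclidean_space.
    (\<integral>\<^sup>+ y. ennreal (gauss t x y) \<partial>lborel) \<le> ennreal (C * t powr (real DIM('a) / 2))"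
proof -
  define n where "n = real DIM('a)"
  have n: "0 < n" by (simp add: n_def)
  define F where "F = fact DIM('a) * 4 ^ DIM('a) * (dyadic_const (2 * n) n * unit_ball_vol n)"
  have "0 \<le> F"
    using n dyadic_const_pos[of "2 * n" n] by (simp add: F_def)
  have "(\<integral>\<^sup>+ y. ennreal (gauss t x y) \<partial>lborel) \<le> ennreal ((unit_ball_vol n + F + 1) * t powr (n / 2))"
    if "0 < t" for t and x :: 'a
  proof -
    define R where "R = sqrt t"
    have R: "0 < R" "R\<^sup>2 = t" using that by (auto simp: R_def)
    have RT: "R powr n = t powr (n / 2)"
      using that by (simp add: R_def powr_half_sqrt[symmetric] powr_powr)
    define G where "G = fact DIM('a) * 4 ^ DIM('a) * R powr (2 * n)"
    have "G \<ge> 0" by (simp add: G_def)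
    have pw: "gauss t x y \<le> indicator {..<R} (norm (x - y)) + G * (norm (x - y) powr - (2 * n) * indicator {R..} (norm (x - y)))"
      for y
    proof (cases "norm (x - y) < R")
      case False
      define v where "v = norm (x - y)"
      have v: "0 < v" "R \<le> v" using False R(1) by (auto simp: v_def)
      have "exp (- (v\<^sup>2 / (4 * t))) \<le> fact DIM('a) * (v\<^sup>2 / (4 * t)) powr - n"
        unfolding n_def using v that by (intro exp_minus_le_powr) auto
      also have "(v\<^sup>2 / (4 * t)) powr - n = 4 ^ DIM('a) * R powr (2 * n) * v powr - (2 * n)"
      proof -
        have "(v\<^sup>2 / (4 * t)) powr - n = (v powr 2 / (4 * R powr 2)) powr - n"
          using v R by (simp add: powr_numeral)
        also have "\<dots> = (v powr 2) powr - n / (4 powr - n * (R powr 2) powr - n)"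
          by (simp add: powr_divide powr_mult)
        also have "\<dots> = v powr - (2 * n) / (4 powr - n * R powr - (2 * n))"
          by (simp add: powr_powr)
        also have "\<dots> = 4 powr n * R powr (2 * n) * v powr - (2 * n)"
          by (simp add: powr_minus divide_inverse)
        also have "(4::real) powr n = 4 ^ DIM('a)"
          by (simp add: n_def powr_realpow)
        finally show ?thesis .
      qed
      finally show ?thesis using v by (simp add: v_def G_def)
    qed (use that in simp)
    have ball: "emeasure lborel {y\<in>space lborel. norm (x - y) < \<rho>} = ennreal (unit_ball_vol n * \<rho> powr n)"
      if "0 < \<rho>" for \<rho>
    proof -
      have "{y\<in>space lborel. norm (x - y) < \<rho>} = ball x \<rho>" by (auto simp: dist_norm)
      then show ?thesis using emeasure_lborel_ball_powr[OF that, of x] by (simp add: n_def)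
    qed
    have "(\<integral>\<^sup>+ y. ennreal (gauss t x y) \<partial>lborel) \<le> (\<integral>\<^sup>+ y. indicator {y\<in>space lborel. norm (x - y) < R} y
        + ennreal G * (ennreal (norm (x - y) powr - (2 * n)) * indicator {R..} (norm (x - y))) \<partial>lborel)"
    proof (intro nn_integral_mono)
      fix y
      show "ennreal (gauss t x y) \<le> indicator {y\<in>space lborel. norm (x - y) < R} y
        + ennreal G * (ennreal (norm (x - y) powr - (2 * n)) * indicator {R..} (norm (x - y)))"
        using ennreal_leI[OF pw[of y]] \<open>G \<ge> 0\<close>
        by (cases "norm (x - y) < R") (auto simp: ennreal_mult' split: if_splits)
    qed
    also have "\<dots> = emeasure lborel {y\<in>space lborel. norm (x - y) < R}
        + ennreal G * (\<integral>\<^sup>+ y. ennreal (norm (x - y) powr - (2 * n)) * indicator {R..} (norm (x - y)) \<partial>lborel)"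
      by (subst nn_integral_add; (subst nn_integral_cmult)?; measurable)
    also have "\<dots> \<le> ennreal (unit_ball_vol n * R powr n)
        + ennreal G * ennreal (dyadic_const (2 * n) n * unit_ball_vol n * R powr (n - 2 * n))"
      using n R
      by (intro add_mono mult_left_mono nn_integral_powr_radial) (auto simp: ball[simplified])
    also have "\<dots> = ennreal ((unit_ball_vol n + F) * R powr n)"
    proof -
      have "G * (dyadic_const (2 * n) n * unit_ball_vol n * R powr (n - 2 * n)) = F * (R powr (2 * n) * R powr (n - 2 * n))"
        by (simp add: G_def F_def mult_ac)
      also have "R powr (2 * n) * R powr (n - 2 * n) = R powr n" by (simp flip: powr_add)
      finally show ?thesis
        using \<open>G \<ge> 0\<close> \<open>0 \<le> F\<close> n by (simp add: ring_distribs flip: ennreal_mult' ennreal_plus)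
    qed
    also have "\<dots> \<le> ennreal ((unit_ball_vol n + F + 1) * R powr n)"
      by (intro ennreal_leI mult_right_mono) auto
    finally show ?thesis by (simp add: RT)
  qed
  then show ?thesis
    using \<open>0 \<le> F\<close> n by (intro exI[of _ "unit_ball_vol n + F + 1"]) (auto simp: n_def intro!: add_nonneg_pos)
qed

lemma heat_integrand_measurable:
  fixes g :: "'a::euclidean_space \<Rightarrow> complex"
  assumes "g \<in> borel_measurable lebesgue"
  shows "(\<lambda>z. gauss t (fst z) (snd z) *\<^sub>R g (snd z))
    \<in> borel_measurable (borel \<Otimes>\<^sub>M (lebesgue :: 'a measure))"
  by (intro borel_measurable_scaleR gauss_pair_measurable measurable_compose[OF measurable_snd assms])

lemma heat_measurable:
  fixes g :: "'a::euclidean_space \<Rightarrow> complex"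
  assumes "g \<in> borel_measurable lebesgue"
  shows "heat t g \<in> borel_measurable borel"
proof -
  interpret L: sigma_finite_measure "lebesgue :: 'a measure" by (rule sigma_finite_lebesgue)
  have "(\<lambda>x. LINT y|lebesgue. gauss t x y *\<^sub>R g y) \<in> borel_measurable lborel"
    using heat_integrand_measurable[OF assms]
    by (intro L.borel_measurable_lebesgue_integral) (simp add: case_prod_beta')
  then show ?thesis unfolding heat_def[abs_def] by simp
qed

text \<open>
  The heat operator without its normalising factor \<open>(4\<pi>t)\<^sup>-\<^sup>n\<^sup>/\<^sup>2\<close>, with values in the extended
  nonnegative reals so that Tonelli's theorem and monotonicity apply before convergence is known.
\<close>

definition heat_nn :: "real \<Rightarrow> ('a::euclidean_space \<Rightarrow> ennreal) \<Rightarrow> 'a \<Rightarrow> ennreal" where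
  "heat_nn t W x = (\<integral>\<^sup>+ y. ennreal (gauss t x y) * W y \<partial>lebesgue)"

lemma heat_nn_measurable:
  fixes W :: "'a::euclidean_space \<Rightarrow> ennreal"
  assumes [measurable]: "W \<in> borel_measurable lebesgue"
  shows "heat_nn t W \<in> borel_measurable lborel"
proof -
  interpret L: sigma_finite_measure "lebesgue :: 'a measure" by (rule sigma_finite_lebesgue)
  show ?thesis unfolding heat_nn_def[abs_def]
    by (intro L.borel_measurable_nn_integral) (simp add: case_prod_beta')
qed

lemma heat_nn_le_mass:
  assumes "0 < t"
  shows "heat_nn t W x \<le> (\<integral>\<^sup>+ y. W y \<partial>lebesgue)"
  unfolding heat_nn_def
proof (rule nn_integral_mono)
  fix y
  have "ennreal (gauss t x y) * W y \<le> 1 * W y"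
    using assms by (intro mult_right_mono) auto
  then show "ennreal (gauss t x y) * W y \<le> W y" by simp
qed

text \<open>
  By Tonelli's theorem and the symmetry of the kernel. The inner variable carries the completed
  measure because \<open>W\<close> is only Lebesgue measurable.
\<close>

lemma nn_integral_heat_nn_le:
  fixes W :: "'a::euclidean_space \<Rightarrow> ennreal"
  assumes [measurable]: "W \<in> borel_measurable lebesgue"
    and mass: "\<And>x::'a. (\<integral>\<^sup>+ y. ennreal (gauss t x y) \<partial>lborel) \<le> m"
  shows "(\<integral>\<^sup>+ x. heat_nn t W x \<partial>lborel) \<le> m * (\<integral>\<^sup>+ y. W y \<partial>lebesgue)"
proof -
  interpret pair_sigma_finite lborel "lebesgue :: 'a measure"
    by (intro pair_sigma_finite.intro sigma_finite_lborel sigma_finite_lebesgue)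
  have "(\<integral>\<^sup>+ x. heat_nn t W x \<partial>lborel) = (\<integral>\<^sup>+ y. (\<integral>\<^sup>+ x. ennreal (gauss t x y) * W y \<partial>lborel) \<partial>lebesgue)"
    unfolding heat_nn_def by (rule Fubini'[symmetric]) (simp add: case_prod_beta')
  also have "\<dots> = (\<integral>\<^sup>+ y. (\<integral>\<^sup>+ x. ennreal (gauss t y x) \<partial>lborel) * W y \<partial>lebesgue)"
    by (intro nn_integral_cong, subst nn_integral_multc) (auto simp: norm_minus_commute)
  also have "\<dots> \<le> (\<integral>\<^sup>+ y. m * W y \<partial>lebesgue)"
    by (intro nn_integral_mono mult_right_mono mass) auto
  also have "\<dots> = m * (\<integral>\<^sup>+ y. W y \<partial>lebesgue)"
    by (intro nn_integral_cmult) simp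
  finally show ?thesis .
qed

lemma norm_heat_le_heat_nn:
  fixes g :: "'a::euclidean_space \<Rightarrow> complex"
  assumes "0 < t"
  shows "ennreal (norm (heat t g x))
    \<le> ennreal (1 / t powr (real DIM('a) / 2)) * heat_nn t (\<lambda>y. ennreal (norm (g y))) x"
proof -
  define A where "A = (LINT y|lebesgue. gauss t x y *\<^sub>R g y)"
  have A: "ennreal (norm A) \<le> heat_nn t (\<lambda>y. ennreal (norm (g y))) x"
  proof (cases "integrable lebesgue (\<lambda>y. gauss t x y *\<^sub>R g y)")
    case True
    from integral_norm_bound_ennreal[OF this] show ?thesis
      by (simp add: A_def heat_nn_def ennreal_mult')
  next
    case False
    then show ?thesis by (simp add: A_def not_integrable_integral_eq)
  qed
  have "t powr (real DIM('a) / 2) = sqrt (t ^ DIM('a))"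
    using assms by (simp add: powr_half_sqrt[symmetric] powr_realpow[symmetric] powr_powr)
  also have "\<dots> \<le> sqrt ((4 * pi * t) ^ DIM('a))"
    using assms pi_ge_two by (intro real_sqrt_le_mono power_mono) auto
  finally have "1 / sqrt ((4 * pi * t) ^ DIM('a)) \<le> 1 / t powr (real DIM('a) / 2)"
    using assms by (intro divide_left_mono) auto
  then have "1 / sqrt ((4 * pi * t) ^ DIM('a)) * norm A \<le> 1 / t powr (real DIM('a) / 2) * norm A"
    by (rule mult_right_mono) simp
  then have "norm (heat t g x) \<le> 1 / t powr (real DIM('a) / 2) * norm A"
    using assms unfolding heat_def A_def[symmetric] by simp
  then have "ennreal (norm (heat t g x)) \<le> ennreal (1 / t powr (real DIM('a) / 2)) * ennreal (norm A)"
    by (simp add: ennreal_leI flip: ennreal_mult')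
  also have "\<dots> \<le> ennreal (1 / t powr (real DIM('a) / 2)) * heat_nn t (\<lambda>y. ennreal (norm (g y))) x"
    by (intro mult_left_mono A) auto
  finally show ?thesis .
qed

text \<open>
  Let \<open>h = |g|/K\<close>. For every level \<open>\<delta>\<close>, \<open>powr_split\<close> gives \<open>h \<le> \<delta> + W\<^sub>\<delta>\<close>, where \<open>W\<^sub>\<delta>\<close> is \<open>h\<close> on \<open>E\<close> and
  \<open>\<delta>\<^sup>1\<^sup>-\<^sup>a h\<^sup>a\<close> off \<open>E\<close>, a function of mass at most \<open>B t\<^sup>n\<^sup>/\<^sup>2 (1 + \<delta>\<^sup>1\<^sup>-\<^sup>a)\<close>. The heat flow maps the
  constant \<open>\<delta>\<close> to at most \<open>c \<delta>\<close>, and \<open>W\<^sub>\<delta>\<close> to a function whose supremum is at most \<open>t\<^sup>-\<^sup>n\<^sup>/\<^sup>2\<close> times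
  that mass and whose integral is at most \<open>c\<close> times it. The uniform bound is the case \<open>\<delta> = 1\<close>. For the
  measure of the set where the flow exceeds \<open>l\<close>, choose \<open>\<delta>\<close> such that the constant contributes only
  \<open>l/2\<close>, and apply Markov's inequality to the rest.
\<close>

lemma heat_L1_plus_La_estimates:
  fixes a B :: real
  assumes "1 \<le> a" "0 < B"
  shows "\<exists>D>0. \<forall>t>0. \<forall>K>0. \<forall>(g :: 'a::euclidean_space \<Rightarrow> complex) E.
    g \<in> borel_measurable lebesgue \<longrightarrow> E \<in> sets lebesgue \<longrightarrow>
    (\<integral>\<^sup>+ y. ennreal (norm (g y)) * indicator E y \<partial>lebesgue) \<le> ennreal (B * K * t powr (real DIM('a) / 2)) \<longrightarrow>
    (\<integral>\<^sup>+ y. ennreal (norm (g y) powr a) * indicator (- E) y \<partial>lebesgue)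
      \<le> ennreal (B * K powr a * t powr (real DIM('a) / 2)) \<longrightarrow>
    heat_defined t g \<and> (\<forall>x. norm (heat t g x) \<le> D * K) \<and>
    (\<forall>l. 0 < l \<longrightarrow> l < D * K \<longrightarrow> emeasure lebesgue {x. norm (heat t g x) > l}
      \<le> ennreal (D * t powr (real DIM('a) / 2) * (D * K / l) powr a))"
proof -
  obtain c where c: "0 < c" and gauss_mass: "\<And>t x::'a. 0 < t \<Longrightarrow>
      (\<integral>\<^sup>+ y. ennreal (gauss t x y) \<partial>lborel) \<le> ennreal (c * t powr (real DIM('a) / 2))"
    using nn_integral_gauss_le[where 'a='a] by blast
  define D where "D = 1 + c + 2 * B + 2 * c * B * (1 + (2 * c) powr (a - 1))"
  have D: "1 \<le> D" "c + 2 * B \<le> D" "2 * c * B * (1 + (2 * c) powr (a - 1)) \<le> D"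
    using c \<open>0 < B\<close> by (auto simp: D_def)
  have main: "heat_defined t g \<and> (\<forall>x. norm (heat t g x) \<le> D * K) \<and>
      (\<forall>l. 0 < l \<longrightarrow> l < D * K \<longrightarrow> emeasure lebesgue {x. norm (heat t g x) > l}
        \<le> ennreal (D * t powr (real DIM('a) / 2) * (D * K / l) powr a))"
    if "0 < t" "0 < K" and g [measurable]: "g \<in> borel_measurable lebesgue"
      and E [measurable]: "E \<in> sets lebesgue"
      and g1: "(\<integral>\<^sup>+ y. ennreal (norm (g y)) * indicator E y \<partial>lebesgue) \<le> ennreal (B * K * t powr (real DIM('a) / 2))"
      and g2: "(\<integral>\<^sup>+ y. ennreal (norm (g y) powr a) * indicator (- E) y \<partial>lebesgue)
        \<le> ennreal (B * K powr a * t powr (real DIM('a) / 2))"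
    for t K and g :: "'a \<Rightarrow> complex" and E
  proof -
    define T where "T = t powr (real DIM('a) / 2)"
    have T: "0 < T" using \<open>0 < t\<close> by (simp add: T_def)
    define W where "W \<delta> y = ennreal (1 / K) * (ennreal (norm (g y)) * indicator E y)
        + ennreal (\<delta> powr (1 - a) / K powr a) * (ennreal (norm (g y) powr a) * indicator (- E) y)" for \<delta> y
    have W [measurable]: "W \<delta> \<in> borel_measurable lebesgue" for \<delta>
      unfolding W_def by measurable
    have mass_W: "(\<integral>\<^sup>+ y. W \<delta> y \<partial>lebesgue) \<le> ennreal (B * T * (1 + \<delta> powr (1 - a)))" for \<delta>
    proof -
      have "(\<integral>\<^sup>+ y. W \<delta> y \<partial>lebesgue)
        = ennreal (1 / K) * (\<integral>\<^sup>+ y. ennreal (norm (g y)) * indicator E y \<partial>lebesgue)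
        + ennreal (\<delta> powr (1 - a) / K powr a) * (\<integral>\<^sup>+ y. ennreal (norm (g y) powr a) * indicator (- E) y \<partial>lebesgue)"
        unfolding W_def by (rule nn_integral_lincomb) measurable
      also have "\<dots> \<le> ennreal (1 / K) * ennreal (B * K * T) + ennreal (\<delta> powr (1 - a) / K powr a) * ennreal (B * K powr a * T)"
        using g1 g2 unfolding T_def by (intro add_mono mult_left_mono) auto
      also have "\<dots> = ennreal (B * T * (1 + \<delta> powr (1 - a)))"
        using \<open>0 < K\<close> \<open>0 < B\<close> T by (simp add: field_simps flip: ennreal_mult' ennreal_plus)
      finally show ?thesis .
    qed
    have g_le: "ennreal (norm (g y)) \<le> ennreal K * (ennreal \<delta> + W \<delta> y)" if "0 < \<delta>" for \<delta> y
    proof -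
      have "norm (g y) / K \<le> \<delta> + \<delta> powr (1 - a) * (norm (g y) / K) powr a"
        using powr_split[of "norm (g y) / K" \<delta> 1 a] that \<open>0 < K\<close> assms by simp
      then have "norm (g y) \<le> K * (\<delta> + \<delta> powr (1 - a) / K powr a * norm (g y) powr a)"
        using \<open>0 < K\<close> by (simp add: powr_divide field_simps)
      moreover have "norm (g y) \<le> K * (\<delta> + 1 / K * norm (g y))"
        using \<open>0 < K\<close> that by (simp add: field_simps)
      ultimately show ?thesis
        using \<open>0 < K\<close> that
        by (cases "y \<in> E") (auto simp: W_def ennreal_leI simp flip: ennreal_mult' ennreal_plus)
    qed
    have heat_g: "heat_nn t (\<lambda>y. ennreal (norm (g y))) x
      \<le> ennreal K * (ennreal (\<delta> * c * T) + heat_nn t (W \<delta>) x)" if "0 < \<delta>" for \<delta> x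
    proof -
      have "heat_nn t (\<lambda>y. ennreal (norm (g y))) x
        \<le> (\<integral>\<^sup>+ y. ennreal (K * \<delta>) * ennreal (gauss t x y) + ennreal K * (ennreal (gauss t x y) * W \<delta> y) \<partial>lebesgue)"
        unfolding heat_nn_def
      proof (intro nn_integral_mono)
        fix y
        have "ennreal (gauss t x y) * ennreal (norm (g y)) \<le> ennreal (gauss t x y) * (ennreal K * (ennreal \<delta> + W \<delta> y))"
          by (intro mult_left_mono g_le that) auto
        also have "\<dots> = ennreal (K * \<delta>) * ennreal (gauss t x y) + ennreal K * (ennreal (gauss t x y) * W \<delta> y)"
          using \<open>0 < K\<close> by (simp only: ennreal_mult'[of K] less_imp_le ring_distribs mult_ac)
        finally show "ennreal (gauss t x y) * ennreal (norm (g y))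
          \<le> ennreal (K * \<delta>) * ennreal (gauss t x y) + ennreal K * (ennreal (gauss t x y) * W \<delta> y)" .
      qed
      also have "\<dots> = ennreal (K * \<delta>) * (\<integral>\<^sup>+ y. ennreal (gauss t x y) \<partial>lebesgue) + ennreal K * heat_nn t (W \<delta>) x"
        unfolding heat_nn_def by (rule nn_integral_lincomb) measurable
      also have "\<dots> \<le> ennreal (K * \<delta>) * ennreal (c * T) + ennreal K * heat_nn t (W \<delta>) x"
        using gauss_mass[OF \<open>0 < t\<close>, of x] unfolding T_def
        by (intro mult_left_mono add_mono) (auto simp: nn_integral_completion)
      also have "\<dots> = ennreal K * (ennreal (\<delta> * c * T) + heat_nn t (W \<delta>) x)"
        using \<open>0 < K\<close> that
        by (simp only: distrib_left mult.assoc ennreal_mult'[of K] ennreal_mult'[of \<delta>] less_imp_le)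
      finally show ?thesis .
    qed
    have norm_heat: "ennreal (norm (heat t g x)) \<le> ennreal (K * \<delta> * c) + ennreal (K / T) * heat_nn t (W \<delta>) x"
      if "0 < \<delta>" for \<delta> x
    proof -
      have "ennreal (norm (heat t g x)) \<le> ennreal (1 / T) * heat_nn t (\<lambda>y. ennreal (norm (g y))) x"
        unfolding T_def by (rule norm_heat_le_heat_nn) fact
      also have "\<dots> \<le> ennreal (1 / T) * (ennreal K * (ennreal (\<delta> * c * T) + heat_nn t (W \<delta>) x))"
        by (intro mult_left_mono heat_g that) auto
      also have "\<dots> = ennreal (K * \<delta> * c) + ennreal (K / T) * heat_nn t (W \<delta>) x"
      proof -
        have 1: "ennreal (1 / T) * (ennreal K * z) = ennreal (K / T) * z" for z
          using T \<open>0 < K\<close> ennreal_mult'[of "1 / T" K] by (simp add: mult.assoc[symmetric])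
        have "ennreal (K / T) * ennreal (\<delta> * c * T) = ennreal (K * \<delta> * c)"
          using T \<open>0 < K\<close> by (subst ennreal_mult'[symmetric]) (auto simp: mult_ac)
        then show ?thesis by (simp only: 1 distrib_left)
      qed
      finally show ?thesis .
    qed
    have defined: "heat_defined t g"
      unfolding heat_defined_def
    proof (intro allI integrableI_bounded)
      fix x
      have "(\<integral>\<^sup>+ y. ennreal (norm (gauss t x y *\<^sub>R g y)) \<partial>lebesgue) = heat_nn t (\<lambda>y. ennreal (norm (g y))) x"
        by (simp add: heat_nn_def ennreal_mult')
      also have "\<dots> \<le> ennreal K * (ennreal (1 * c * T) + heat_nn t (W 1) x)"
        by (rule heat_g) simp
      also have "\<dots> \<le> ennreal K * (ennreal (1 * c * T) + ennreal (B * T * (1 + 1 powr (1 - a))))"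
        by (intro mult_left_mono add_mono order_trans[OF heat_nn_le_mass mass_W]) (use \<open>0 < t\<close> in auto)
      also have "\<dots> < \<infinity>" by (simp add: ennreal_mult_less_top)
      finally show "(\<integral>\<^sup>+ y. ennreal (norm (gauss t x y *\<^sub>R g y)) \<partial>lebesgue) < \<infinity>" .
    qed measurable
    have sup: "norm (heat t g x) \<le> D * K" for x
    proof -
      have "ennreal (norm (heat t g x)) \<le> ennreal (K * 1 * c) + ennreal (K / T) * heat_nn t (W 1) x"
        by (rule norm_heat) simp
      also have "\<dots> \<le> ennreal (K * 1 * c) + ennreal (K / T) * ennreal (B * T * (1 + 1 powr (1 - a)))"
        by (intro mult_left_mono add_mono order_trans[OF heat_nn_le_mass mass_W]) (use \<open>0 < t\<close> in auto)
      also have "\<dots> = ennreal (K * (c + 2 * B))"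
        using T \<open>0 < K\<close> c \<open>0 < B\<close> by (simp add: field_simps flip: ennreal_mult' ennreal_plus)
      finally have "norm (heat t g x) \<le> K * (c + 2 * B)"
        using \<open>0 < K\<close> c \<open>0 < B\<close> by (simp add: ennreal_le_iff)
      also have "\<dots> \<le> D * K" using D \<open>0 < K\<close> by simp
      finally show ?thesis .
    qed
    have dist: "emeasure lebesgue {x. norm (heat t g x) > l} \<le> ennreal (D * T * (D * K / l) powr a)"
      if l: "0 < l" "l < D * K" for l
    proof -
      \<comment> \<open>With this level the constant \<open>\<delta>\<close> contributes \<open>K \<delta> c = l/2\<close>.\<close>
      define \<delta> where "\<delta> = l / (2 * c * K)"
      have \<delta>: "0 < \<delta>" using l c \<open>0 < K\<close> by (simp add: \<delta>_def)
      define H where "H = heat_nn t (W \<delta>)"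
      have H [measurable]: "H \<in> borel_measurable lborel"
        unfolding H_def by (rule heat_nn_measurable) measurable
      \<comment> \<open>The factor that turns the remaining inequality \<open>l/2 < (K/T) H x\<close> into \<open>1 < \<kappa> H x\<close>.\<close>
      define \<kappa> where "\<kappa> = 2 * K / (l * T)"
      have \<kappa>: "0 < \<kappa>" using l T \<open>0 < K\<close> by (simp add: \<kappa>_def)
      have "1 \<le> ennreal \<kappa> * H x" if "norm (heat t g x) > l" for x
      proof (cases "H x = \<infinity>")
        case False
        then obtain h where h: "0 \<le> h" "H x = ennreal h" by (cases "H x") auto
        have "ennreal (norm (heat t g x)) \<le> ennreal (K * \<delta> * c + K / T * h)"
          using norm_heat[OF \<delta>, of x] h T \<open>0 < K\<close> \<delta> c by (simp add: H_def flip: ennreal_mult' ennreal_plus)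
        then have "norm (heat t g x) \<le> K * \<delta> * c + K / T * h"
          using h T \<open>0 < K\<close> \<delta> c by (subst (asm) ennreal_le_iff) auto
        moreover have "K * \<delta> * c = l / 2" using c \<open>0 < K\<close> by (simp add: \<delta>_def)
        ultimately have "l / 2 \<le> K / T * h" using that by linarith
        then have "1 \<le> \<kappa> * h" using l T by (simp add: \<kappa>_def field_simps)
        then show ?thesis using h \<kappa> by (simp flip: ennreal_mult' ennreal_1)
      qed (use \<kappa> in \<open>auto simp: ennreal_mult_top\<close>)
      then have sub: "{x. norm (heat t g x) > l} \<subseteq> {x\<in>UNIV. 1 \<le> ennreal \<kappa> * H x}" by auto
      have "emeasure lebesgue {x. norm (heat t g x) > l} = emeasure lborel {x. norm (heat t g x) > l}"
      proof -
        have [measurable]: "heat t g \<in> borel_measurable borel" by (rule heat_measurable) measurable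
        have "{x\<in>space borel. norm (heat t g x) > l} \<in> sets borel" by measurable
        then show ?thesis by simp
      qed
      also have "\<dots> \<le> emeasure lborel {x\<in>UNIV. 1 \<le> ennreal \<kappa> * H x}"
        by (intro emeasure_mono sub) measurable
      also have "\<dots> \<le> ennreal \<kappa> * (\<integral>\<^sup>+ x. H x * indicator UNIV x \<partial>lborel)"
        by (rule nn_integral_Markov_inequality) auto
      also have "\<dots> \<le> ennreal \<kappa> * (ennreal (c * T) * ennreal (B * T * (1 + \<delta> powr (1 - a))))"
        using order_trans[OF nn_integral_heat_nn_le[OF W gauss_mass[OF \<open>0 < t\<close>]] mult_left_mono[OF mass_W]]
        unfolding H_def by (intro mult_left_mono) (auto simp: T_def)
      also have "\<dots> = ennreal (\<kappa> * (c * T * (B * T * (1 + \<delta> powr (1 - a)))))"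
        using \<kappa> c T by (simp add: ennreal_mult')
      also have "\<dots> \<le> ennreal (D * T * (D * K / l) powr a)"
      proof (intro ennreal_leI)
        define z where "z = D * K / l"
        \<comment> \<open>Only levels below \<open>D K\<close> matter, so up to a constant \<open>K/l\<close> is dominated by its \<open>a\<close>-th power.\<close>
        have z: "1 < z" using l by (simp add: z_def)
        have K_l: "K / l = z / D" using D by (simp add: z_def)
        have 1: "K / l \<le> z powr a"
        proof -
          have "K / l \<le> z" using z D unfolding K_l by (simp add: field_simps)
          also have "z \<le> z powr a" using z assms powr_mono[of 1 a z] by simp
          finally show ?thesis .
        qed
        have 2: "K / l * \<delta> powr (1 - a) \<le> (2 * c) powr (a - 1) * z powr a"
        proof -
          have "\<delta> = (2 * c * (K / l)) powr - 1"
            using c \<open>0 < K\<close> l by (simp add: \<delta>_def powr_minus field_simps)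
          then have "\<delta> powr (1 - a) = (2 * c * (K / l)) powr (a - 1)"
            by (simp only: powr_powr) simp
          also have "\<dots> = (2 * c) powr (a - 1) * (K / l) powr (a - 1)"
            using c \<open>0 < K\<close> l by (subst powr_mult) auto
          finally have "K / l * \<delta> powr (1 - a) = (2 * c) powr (a - 1) * ((K / l) powr 1 * (K / l) powr (a - 1))"
            using \<open>0 < K\<close> l by simp
          also have "(K / l) powr 1 * (K / l) powr (a - 1) = (K / l) powr a"
            by (simp only: powr_add[symmetric]) simp
          also have "(K / l) powr a \<le> z powr a"
            using D z l \<open>0 < K\<close> assms unfolding K_l
            by (intro powr_mono2) (auto simp: field_simps)
          finally show ?thesis by (simp add: mult_left_mono)
        qed
        have "\<kappa> * (c * T * (B * T * (1 + \<delta> powr (1 - a)))) = T * (2 * c * B) * (K / l + K / l * \<delta> powr (1 - a))"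
          using T l by (simp add: \<kappa>_def field_simps)
        also have "\<dots> \<le> T * (2 * c * B) * (z powr a + (2 * c) powr (a - 1) * z powr a)"
          using T c \<open>0 < B\<close> 1 2 by (intro mult_left_mono add_mono) auto
        also have "\<dots> = T * z powr a * (2 * c * B * (1 + (2 * c) powr (a - 1)))"
          by (simp add: algebra_simps)
        also have "\<dots> \<le> T * z powr a * D"
          using T D by (intro mult_left_mono) auto
        finally show "\<kappa> * (c * T * (B * T * (1 + \<delta> powr (1 - a)))) \<le> D * T * (D * K / l) powr a"
          by (simp add: z_def mult_ac)
      qed
      finally show ?thesis .
    qed
    show ?thesis using defined sup dist by (auto simp: T_def)
  qed
  have "0 < D" using D by simp
  then show ?thesis using main by blast
qed

section \<open>The smoothing estimate with singular weight\<close>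

lemma weight_measurable:
  fixes f :: "'a::euclidean_space \<Rightarrow> complex"
  assumes [measurable]: "f \<in> borel_measurable lebesgue"
  shows "weight \<gamma> f \<in> borel_measurable lebesgue"
  unfolding weight_def[abs_def] by measurable

lemma heat_weight_lorentz_estimate:
  fixes p q s \<gamma> :: real and r :: ennreal
  defines "n \<equiv> real DIM('a::euclidean_space)"
  assumes "1 < q" and "q < p" and "1 \<le> r" and "q \<le> s"
    and "n / q - n / p < \<gamma>" and "\<gamma> < n - n / p"
  shows "\<exists>C>0. \<forall>t>0. \<forall>f :: 'a \<Rightarrow> complex. f \<in> morrey_space p q r \<longrightarrow>
    heat_defined t (weight \<gamma> f) \<and>
    heat t (weight \<gamma> f) \<in> lorentz_space s r \<and>
    lorentz_norm s r (heat t (weight \<gamma> f))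
      \<le> ennreal (C * t powr (- (n / 2) * (1 / p - 1 / s) - \<gamma> / 2)) * morrey_norm p q r f"
proof -
  define \<sigma> where "\<sigma> = \<gamma> + n / p"
  have n: "0 < n" by (simp add: n_def)
  have "n / q < \<sigma>" "\<sigma> < n" using assms by (auto simp: \<sigma>_def)
  moreover have "0 < n / q" using n assms by simp
  ultimately have "0 < \<sigma>" by simp
  have "n / \<sigma> < q" using \<open>n / q < \<sigma>\<close> \<open>0 < \<sigma>\<close> assms by (simp add: field_simps)
  \<comment> \<open>\<open>a\<close> above \<open>n/\<sigma>\<close> gives decay at infinity; \<open>a\<close> below \<open>q\<close> gives \<open>a < s\<close> even when \<open>s = q\<close>.\<close>
  then obtain a where a: "n / \<sigma> < a" "a < q" using dense by blast
  have "1 < n / \<sigma>" using \<open>\<sigma> < n\<close> \<open>0 < \<sigma>\<close> by simp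
  then have "1 < a" using a by simp
  have "n < a * \<sigma>" using a \<open>0 < \<sigma>\<close> by (simp add: field_simps)
  have "a < s" using a assms by simp
  define B where "B = max 1 (max (weight_const n p q \<gamma> 1) (weight_const n p q \<gamma> a))"
  have B: "0 < B" "weight_const n p q \<gamma> 1 \<le> B" "weight_const n p q \<gamma> a \<le> B" by (auto simp: B_def)
  obtain c where "0 < c" and c: "\<And>(f :: 'a \<Rightarrow> complex) x \<rho>. 0 < \<rho> \<Longrightarrow>
      ennreal (\<rho> powr (n / p - n / q)) *
        enn_powr (\<integral>\<^sup>+ y\<in>ball x \<rho>. ennreal (norm (f y) powr q) \<partial>lebesgue) (1 / q)
      \<le> ennreal c * morrey_norm p q r f"
    using morrey_norm_ball_le[of q p r, where 'a='a] assms unfolding n_def by auto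
  obtain D where "0 < D" and heat: "\<And>t K (g :: 'a \<Rightarrow> complex) E. 0 < t \<Longrightarrow> 0 < K \<Longrightarrow>
      g \<in> borel_measurable lebesgue \<Longrightarrow> E \<in> sets lebesgue \<Longrightarrow>
      (\<integral>\<^sup>+ y. ennreal (norm (g y)) * indicator E y \<partial>lebesgue) \<le> ennreal (B * K * t powr (n / 2)) \<Longrightarrow>
      (\<integral>\<^sup>+ y. ennreal (norm (g y) powr a) * indicator (- E) y \<partial>lebesgue)
        \<le> ennreal (B * K powr a * t powr (n / 2)) \<Longrightarrow>
      heat_defined t g \<and> (\<forall>x. norm (heat t g x) \<le> D * K) \<and>
      (\<forall>l. 0 < l \<longrightarrow> l < D * K \<longrightarrow> emeasure lebesgue {x. norm (heat t g x) > l}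
        \<le> ennreal (D * t powr (n / 2) * (D * K / l) powr a))"
    using heat_L1_plus_La_estimates[of a B, where 'a='a] \<open>1 < a\<close> B(1) unfolding n_def by force
  obtain C where "0 < C" and lorentz: "\<And>(h :: 'a \<Rightarrow> complex) L V.
      h \<in> borel_measurable lebesgue \<Longrightarrow> 0 < L \<Longrightarrow> 0 < V \<Longrightarrow> (\<forall>x. norm (h x) \<le> L) \<Longrightarrow>
      (\<forall>l. 0 < l \<longrightarrow> l < L \<longrightarrow> emeasure lebesgue {x. norm (h x) > l} \<le> ennreal (V * (L / l) powr a)) \<Longrightarrow>
      lorentz_norm s r h \<le> ennreal (C * V powr (1 / s) * L)"
    using lorentz_norm_le[of a s r, where 'a='a] \<open>1 < a\<close> \<open>a < s\<close> assms by force
  define C' where "C' = C * D powr (1 / s) * D"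
  have "0 < C'" using \<open>0 < C\<close> \<open>0 < D\<close> by (simp add: C'_def)
  have main: "heat_defined t (weight \<gamma> f) \<and>
      lorentz_norm s r (heat t (weight \<gamma> f))
        \<le> ennreal (C' * M * t powr (- (n / 2) * (1 / p - 1 / s) - \<gamma> / 2))"
    if "0 < t" and f [measurable]: "f \<in> borel_measurable lebesgue"
      and "0 < M" and M: "ennreal c * morrey_norm p q r f \<le> ennreal M"
    for t M and f :: "'a \<Rightarrow> complex"
  proof -
    define g where "g = weight \<gamma> f"
    define R where "R = sqrt t"
    have R: "0 < R" using \<open>0 < t\<close> by (simp add: R_def)
    have RT: "R powr b = t powr (b / 2)" for b
      using \<open>0 < t\<close> by (simp add: R_def powr_half_sqrt[symmetric] powr_powr)
    define K where "K = M * R powr - \<sigma>"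
    have K: "0 < K" using R \<open>0 < M\<close> by (simp add: K_def)
    have [measurable]: "g \<in> borel_measurable lebesgue"
      unfolding g_def by (rule weight_measurable) fact
    have ball: "(\<integral>\<^sup>+ y\<in>ball 0 \<rho>. ennreal (norm (f y) powr q) \<partial>lebesgue)
      \<le> ennreal ((M * \<rho> powr (n / q - n / p)) powr q)" if "0 < \<rho>" for \<rho>
    proof (rule le_of_enn_powr_le)
      let ?I = "enn_powr (\<integral>\<^sup>+ y\<in>ball 0 \<rho>. ennreal (norm (f y) powr q) \<partial>lebesgue) (1 / q)"
      have "?I = ennreal (\<rho> powr (n / q - n / p)) * (ennreal (\<rho> powr (n / p - n / q)) * ?I)"
        using that by (simp add: mult.assoc[symmetric] flip: ennreal_mult' powr_add)
      also have "\<dots> \<le> ennreal (\<rho> powr (n / q - n / p)) * ennreal M"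
        by (intro mult_left_mono order_trans[OF c[OF that] M]) auto
      finally show "?I \<le> ennreal (M * \<rho> powr (n / q - n / p))"
        using \<open>0 < M\<close> by (simp add: mult.commute flip: ennreal_mult')
    qed (use \<open>0 < M\<close> assms in auto)
    define E where "E = ball (0::'a) R"
    have inner: "(\<integral>\<^sup>+ y. ennreal (norm (g y)) * indicator E y \<partial>lebesgue) \<le> ennreal (B * K * t powr (n / 2))"
    proof -
      have "(\<integral>\<^sup>+ y. ennreal (norm (g y)) * indicator E y \<partial>lebesgue)
        = (\<integral>\<^sup>+ y. ennreal (norm (weight \<gamma> f y) powr 1) * indicator {..<R} (norm y) \<partial>lebesgue)"
        by (intro nn_integral_cong) (auto simp: E_def g_def indicator_def)
      also have "\<dots> \<le> ennreal (weight_const n p q \<gamma> 1 * M powr 1 * R powr (n - 1 * \<sigma>))"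
        unfolding n_def \<sigma>_def using \<open>0 < M\<close> R assms ball[unfolded n_def]
        by (intro nn_integral_weight_le) (auto simp: n_def)
      also have "\<dots> \<le> ennreal (B * M powr 1 * R powr (n - 1 * \<sigma>))"
        using \<open>0 < M\<close> B by (intro ennreal_leI mult_right_mono) auto
      also have "B * M powr 1 * R powr (n - 1 * \<sigma>) = B * K * t powr (n / 2)"
        using \<open>0 < M\<close> R by (simp add: K_def RT[symmetric] powr_diff powr_minus field_simps)
      finally show ?thesis .
    qed
    have outer: "(\<integral>\<^sup>+ y. ennreal (norm (g y) powr a) * indicator (- E) y \<partial>lebesgue)
      \<le> ennreal (B * K powr a * t powr (n / 2))"
    proof -
      have "(\<integral>\<^sup>+ y. ennreal (norm (g y) powr a) * indicator (- E) y \<partial>lebesgue)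
        = (\<integral>\<^sup>+ y. ennreal (norm (weight \<gamma> f y) powr a) * indicator {R..} (norm y) \<partial>lebesgue)"
        by (intro nn_integral_cong) (auto simp: E_def g_def indicator_def)
      also have "\<dots> \<le> ennreal (weight_const n p q \<gamma> a * M powr a * R powr (n - a * \<sigma>))"
        unfolding n_def \<sigma>_def using \<open>0 < M\<close> R \<open>1 < a\<close> a(2) \<open>n < a * \<sigma>\<close> ball[unfolded n_def]
        by (intro nn_integral_weight_le) (auto simp: n_def \<sigma>_def)
      also have "\<dots> \<le> ennreal (B * M powr a * R powr (n - a * \<sigma>))"
        using \<open>0 < M\<close> B by (intro ennreal_leI mult_right_mono) auto
      also have "B * M powr a * R powr (n - a * \<sigma>) = B * K powr a * t powr (n / 2)"
      proof -
        have "K powr a = M powr a * R powr - (a * \<sigma>)"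
          using \<open>0 < M\<close> R by (simp add: K_def powr_mult powr_powr mult.commute)
        then show ?thesis
          by (simp add: RT[symmetric] powr_diff powr_minus field_simps)
      qed
      finally show ?thesis .
    qed
    have E: "E \<in> sets lebesgue" by (simp add: E_def)
    note est = heat[OF \<open>0 < t\<close> K _ E inner outer, simplified]
    have "lorentz_norm s r (heat t g) \<le> ennreal (C * (D * t powr (n / 2)) powr (1 / s) * (D * K))"
      using est \<open>0 < D\<close> K \<open>0 < t\<close> heat_measurable[of g t]
      by (intro lorentz) (auto intro: measurable_completion)
    also have "C * (D * t powr (n / 2)) powr (1 / s) * (D * K)
      = C' * M * t powr (- (n / 2) * (1 / p - 1 / s) - \<gamma> / 2)"
    proof -
      have "C * (D * t powr (n / 2)) powr (1 / s) * (D * K) = C' * M * (t powr (n / 2 / s) * t powr (- \<sigma> / 2))"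
        using \<open>0 < D\<close> \<open>0 < t\<close> by (simp add: C'_def K_def RT powr_mult powr_powr)
      also have "t powr (n / 2 / s) * t powr (- \<sigma> / 2) = t powr (n / 2 / s + - \<sigma> / 2)"
        by (rule powr_add[symmetric])
      also have "n / 2 / s + - \<sigma> / 2 = - (n / 2) * (1 / p - 1 / s) - \<gamma> / 2"
        by (simp add: \<sigma>_def algebra_simps add_divide_distrib diff_divide_distrib)
      finally show ?thesis .
    qed
    finally show ?thesis using est by (simp add: g_def)
  qed
  show ?thesis
  proof (intro exI[of _ "C' * c"] conjI allI impI)
    show "0 < C' * c" using \<open>0 < C'\<close> \<open>0 < c\<close> by simp
    fix t :: real and f :: "'a \<Rightarrow> complex"
    assume "0 < t" and f: "f \<in> morrey_space p q r"
    have f_meas [measurable]: "f \<in> borel_measurable lebesgue" using f by (simp add: morrey_space_def)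
    obtain m where m: "0 \<le> m" "morrey_norm p q r f = ennreal m"
      using f by (cases "morrey_norm p q r f") (auto simp: morrey_space_def)
    define \<tau> where "\<tau> = t powr (- (n / 2) * (1 / p - 1 / s) - \<gamma> / 2)"
    have \<tau>: "0 < \<tau>" using \<open>0 < t\<close> by (simp add: \<tau>_def)
    have M: "ennreal c * morrey_norm p q r f \<le> ennreal (c * m + e)" if "0 < e" for e
      using that m \<open>0 < c\<close> by (simp add: ennreal_leI flip: ennreal_mult')
    \<comment> \<open>The estimate needs a positive \<open>M\<close>; the slack \<open>e\<close> also covers functions of norm \<open>0\<close> and is removed at the end.\<close>
    have bound: "heat_defined t (weight \<gamma> f) \<and> lorentz_norm s r (heat t (weight \<gamma> f)) \<le> ennreal (C' * (c * m + e) * \<tau>)"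
      if "0 < e" for e
      unfolding \<tau>_def using that m \<open>0 < c\<close> by (intro main \<open>0 < t\<close> f_meas M add_nonneg_pos) auto
    show "heat_defined t (weight \<gamma> f)" using bound[of 1] by simp
    show le: "lorentz_norm s r (heat t (weight \<gamma> f)) \<le> ennreal (C' * c * \<tau>) * morrey_norm p q r f"
    proof (rule ennreal_le_epsilon)
      fix e :: real assume "0 < e"
      have "lorentz_norm s r (heat t (weight \<gamma> f)) \<le> ennreal (C' * (c * m + e / (C' * \<tau>)) * \<tau>)"
        using \<open>0 < e\<close> \<open>0 < C'\<close> \<tau> bound[of "e / (C' * \<tau>)"] by simp
      also have "C' * (c * m + e / (C' * \<tau>)) * \<tau> = C' * c * \<tau> * m + e"
        using \<open>0 < C'\<close> \<tau> by (simp add: field_simps)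
      also have "ennreal (C' * c * \<tau> * m + e) = ennreal (C' * c * \<tau>) * morrey_norm p q r f + ennreal e"
        using m \<open>0 < C'\<close> \<open>0 < c\<close> \<tau> \<open>0 < e\<close> by (simp flip: ennreal_mult' ennreal_plus)
      finally show "lorentz_norm s r (heat t (weight \<gamma> f)) \<le> ennreal (C' * c * \<tau>) * morrey_norm p q r f + ennreal e" .
    qed
    have "heat t (weight \<gamma> f) \<in> borel_measurable lebesgue"
      using heat_measurable[OF weight_measurable[OF f_meas]] by (intro measurable_completion) simp
    moreover have "lorentz_norm s r (heat t (weight \<gamma> f)) < \<infinity>"
      using bound[of 1] by (auto intro: le_less_trans)
    ultimately show "heat t (weight \<gamma> f) \<in> lorentz_space s r"
      by (simp add: lorentz_space_def)
  qed
qed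

theorem theorem4p3:
  fixes p q s \<gamma> :: real and r :: ennreal
  assumes "1 < q" and "q < p" and "1 \<le> r" and "1 < s" and "\<gamma> > 0"
    and "q \<le> s"
    and "real CARD('n::finite) / q - real CARD('n) / p < \<gamma>"
    and "\<gamma> < real CARD('n) - real CARD('n) / p"
  shows "\<exists>C>0. \<forall>t>0. \<forall>f :: real ^ 'n \<Rightarrow> complex. f \<in> morrey_space p q r \<longrightarrow>
    heat_defined t (weight \<gamma> f) \<and>
    heat t (weight \<gamma> f) \<in> lorentz_space s r \<and>
    lorentz_norm s r (heat t (weight \<gamma> f))
      \<le> ennreal (C * t powr (- (real CARD('n) / 2) * (1 / p - 1 / s) - \<gamma> / 2)) *
         morrey_norm p q r f"
proof -
  have dim: "DIM(real ^ 'n) = CARD('n)" by simp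
  show ?thesis
    using heat_weight_lorentz_estimate[of q p r s \<gamma>, where 'a = "real ^ 'n"] assms
    unfolding dim by blast
qed

end
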